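(* Let $M$ be a connected closed $n$-manifold, $n\geq 1$. Suppose $M$ admits a Morse function $f$ with a unique minimum (i.e. a unique critical point of index $0$) and no critical point of index $1$. Then, for every Riemannian metric $g$ on $M$ adapted to $f$, $$\dim\mathscr{D}^2(M,g)\le K^{n,2}_0,$$ where $K^{n,2}_0=1$ if $n=1$, $K^{n,2}_0=3$ if $n=2$, and $K^{n,2}_0=\frac1n\binom{n+2}{3}\binom{n+1}{2}-\frac{n(n+3)}{2}$ if $n\ge 3$.
   Context: $S^p(M)=\Gamma(\mathrm{Sym}^p(T^*M))$ is the space of smooth symmetric covariant $p$-tensors. With $\nabla$ induced by the Levi-Civita connection of $g$, $\{e_k\}$ a local orthonormal frame and $\{e^k\}$ its dual coframe, the symmetric covariant derivative is $d^s:S^p(M)\to S^{p+1}(M)$, $d^s\alpha=\sum_k e^k\,\nabla_{e_k}\alpha$ (symmetric product, with the convention $\alpha_1\cdots\alpha_p=\sum_{\sigma\in\mathfrak{S}_p}\alpha_{\sigma(1)}\otimes\cdots\otimes\alpha_{\sigma(p)}$ for 1-forms), and the divergence operator is $d^{s*}:S^{p+1}(M)\to S^p(M)$, $d^{s*}\alpha=-\sum_k e_k\lrcorner\nabla_{e_k}\alpha$. A symmetric tensor $\alpha$ is Killing if $d^s\alpha=0$ and divergence-free if $d^{s*}\alpha=0$; $\mathscr{D}^p(M,g)=\ker d^s\cap\ker d^{s*}\subset S^p(M)$ is the space of divergence-free symmetric Killing $p$-tensors. A Riemannian metric $g$ is adapted to a Morse function $f$ if around each critical point $x$ of $f$, of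 index $m$ say, there are local coordinates $y_1,\dots,y_n$ with $y_k(x)=0$, $f(y)=f(0)-\frac12 y_1^2-\cdots-\frac12y_m^2+\frac12y_{m+1}^2+\cdots+\frac12y_n^2$, and $g=(dy_1)^2+\cdots+(dy_n)^2$. *)

theory Defs
  imports "HOL-Analysis.Analysis" "HOL-Library.Function_Algebras"
begin

section \<open>Smooth manifolds\<close>

text \<open>Iterated Frechet differentiability on a set that is meant to be open.\<close>

primrec C_times :: "nat \<Rightarrow> 'a set \<Rightarrow> ('a::real_normed_vector \<Rightarrow> 'b::real_normed_vector) \<Rightarrow> bool" where
  "C_times 0 S f \<longleftrightarrow> continuous_on S f"
| "C_times (Suc k) S f \<longleftrightarrow>
     (\<forall>x\<in>S. f differentiable (at x)) \<and> (\<forall>v. C_times k S (\<lambda>x. frechet_derivative f (at x) v))"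

definition smooth_on :: "'a set \<Rightarrow> ('a::real_normed_vector \<Rightarrow> 'b::real_normed_vector) \<Rightarrow> bool" where
  "smooth_on S f \<longleftrightarrow> (\<forall>k. C_times k S f)"

text \<open>
  A chart is a domain together with a coordinate map; the values of the coordinate map off the
  domain are irrelevant.  The dimension of the manifold is the cardinality of the index type.
\<close>

type_synonym ('a, 'n) chart = "'a set \<times> ('a \<Rightarrow> real ^ 'n)"

abbreviation cdom :: "('a, 'n) chart \<Rightarrow> 'a set" where
  "cdom c \<equiv> fst c"

abbreviation coord :: "('a, 'n) chart \<Rightarrow> 'a \<Rightarrow> real ^ 'n" where
  "coord c \<equiv> snd c"

definition param :: "('a, 'n) chart \<Rightarrow> real ^ 'n \<Rightarrow> 'a" where
  "param c = inv_into (cdom c) (coord c)"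

definition is_chart :: "'a topology \<Rightarrow> ('a, 'n::finite) chart \<Rightarrow> bool" where
  "is_chart M c \<longleftrightarrow>
     openin M (cdom c) \<and> open (coord c ` cdom c) \<and>
     homeomorphic_map (subtopology M (cdom c)) (top_of_set (coord c ` cdom c)) (coord c)"

definition compatible :: "('a, 'n::finite) chart \<Rightarrow> ('a, 'n) chart \<Rightarrow> bool" where
  "compatible c d \<longleftrightarrow>
     smooth_on (coord c ` (cdom c \<inter> cdom d)) (coord d \<circ> param c) \<and>
     smooth_on (coord d ` (cdom c \<inter> cdom d)) (coord c \<circ> param d)"

definition smooth_manifold :: "'a topology \<Rightarrow> ('a, 'n::finite) chart set \<Rightarrow> bool" where
  "smooth_manifold M A \<longleftrightarrow>
     Hausdorff_space M \<and> second_countable M \<and>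
     (\<forall>c\<in>A. is_chart M c) \<and> (\<Union>c\<in>A. cdom c) = topspace M \<and>
     (\<forall>c\<in>A. \<forall>d\<in>A. compatible c d) \<and>
     (\<forall>c. is_chart M c \<and> (\<forall>d\<in>A. compatible c d) \<longrightarrow> c \<in> A)"

definition smooth_fun :: "('a, 'n::finite) chart set \<Rightarrow> ('a \<Rightarrow> real) \<Rightarrow> bool" where
  "smooth_fun A f \<longleftrightarrow> (\<forall>c\<in>A. smooth_on (coord c ` cdom c) (f \<circ> param c))"

text \<open>The coordinate derivative of \<open>f\<close> at \<open>x\<close> in the \<open>i\<close>-th direction of the chart \<open>c\<close>.\<close>

definition pd :: "('a, 'n::finite) chart \<Rightarrow> 'n \<Rightarrow> ('a \<Rightarrow> real) \<Rightarrow> 'a \<Rightarrow> real" where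
  "pd c i f x = frechet_derivative (f \<circ> param c) (at (coord c x)) (axis i 1)"


section \<open>Morse functions\<close>

definition hessian :: "('a, 'n::finite) chart \<Rightarrow> ('a \<Rightarrow> real) \<Rightarrow> 'a \<Rightarrow> real ^ 'n ^ 'n" where
  "hessian c f x = (\<chi> i j. pd c i (pd c j f) x)"

definition critical_point :: "'a topology \<Rightarrow> ('a, 'n::finite) chart set \<Rightarrow> ('a \<Rightarrow> real) \<Rightarrow> 'a \<Rightarrow> bool" where
  "critical_point M A f x \<longleftrightarrow> x \<in> topspace M \<and> (\<forall>c\<in>A. x \<in> cdom c \<longrightarrow> (\<forall>i. pd c i f x = 0))"

definition morse_function :: "'a topology \<Rightarrow> ('a, 'n::finite) chart set \<Rightarrow> ('a \<Rightarrow> real) \<Rightarrow> bool" where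
  "morse_function M A f \<longleftrightarrow>
     smooth_fun A f \<and>
     (\<forall>x. critical_point M A f x \<longrightarrow> (\<forall>c\<in>A. x \<in> cdom c \<longrightarrow> invertible (hessian c f x)))"

definition negative_index :: "real ^ 'n ^ 'n \<Rightarrow> nat" where
  "negative_index H = Max {dim V | V. subspace V \<and> (\<forall>v\<in>V. v \<noteq> 0 \<longrightarrow> v \<bullet> (H *v v) < 0)}"

text \<open>
  At a critical point the Hessian is a well-defined quadratic form on the tangent space, so the
  choice of the chart does not matter there.
\<close>

definition morse_index :: "('a, 'n::finite) chart set \<Rightarrow> ('a \<Rightarrow> real) \<Rightarrow> 'a \<Rightarrow> nat" where
  "morse_index A f x = negative_index (hessian (SOME c. c \<in> A \<and> x \<in> cdom c) f x)"


section \<open>Symmetric covariant tensors\<close>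

text \<open>
  A covariant \<open>p\<close>-tensor field \<open>\<alpha>\<close> is given by its components: \<open>\<alpha> c x [i\<^sub>1, \<dots>, i\<^sub>p]\<close> is the value of
  \<open>\<alpha>\<close> at the point \<open>x\<close> on the coordinate vectors \<open>\<partial>\<^bsub>i\<^sub>1\<^esub>, \<dots>, \<partial>\<^bsub>i\<^sub>p\<^esub>\<close> of the chart \<open>c\<close>.  The components
  in different charts are related by the transformation law.  Components that have no
  meaning are required to be zero, so that a tensor field is represented by exactly one function.
\<close>

type_synonym ('a, 'n) tensor = "('a, 'n) chart \<Rightarrow> 'a \<Rightarrow> 'n list \<Rightarrow> real"

text \<open>The derivative of the \<open>i\<close>-th coordinate of \<open>d\<close> in the \<open>j\<close>-th direction of \<open>c\<close>.\<close>

definition jacobian :: "('a, 'n::finite) chart \<Rightarrow> ('a, 'n) chart \<Rightarrow> 'a \<Rightarrow> 'n \<Rightarrow> 'n \<Rightarrow> real" where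
  "jacobian c d x i j = pd c j (\<lambda>z. coord d z $ i) x"

definition covariant_tensor :: "('a, 'n::finite) chart set \<Rightarrow> nat \<Rightarrow> ('a, 'n) tensor \<Rightarrow> bool" where
  "covariant_tensor A p \<alpha> \<longleftrightarrow>
     (\<forall>c x js. \<not> (c \<in> A \<and> x \<in> cdom c \<and> length js = p) \<longrightarrow> \<alpha> c x js = 0) \<and>
     (\<forall>c\<in>A. \<forall>d\<in>A. \<forall>x \<in> cdom c \<inter> cdom d. \<forall>js. length js = p \<longrightarrow>
        \<alpha> c x js = (\<Sum>is | length is = p. (\<Prod>k<p. jacobian c d x (is ! k) (js ! k)) * \<alpha> d x is)) \<and>
     (\<forall>c\<in>A. \<forall>js. smooth_on (coord c ` cdom c) (\<lambda>y. \<alpha> c (param c y) js))"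

definition sym_tensors :: "('a, 'n::finite) chart set \<Rightarrow> nat \<Rightarrow> ('a, 'n) tensor set" where
  "sym_tensors A p =
     {\<alpha>. covariant_tensor A p \<alpha> \<and> (\<forall>c x is js. mset is = mset js \<longrightarrow> \<alpha> c x is = \<alpha> c x js)}"

definition scale_tensor :: "real \<Rightarrow> ('a, 'n) tensor \<Rightarrow> ('a, 'n) tensor" where
  "scale_tensor r \<alpha> = (\<lambda>c x is. r * \<alpha> c x is)"

global_interpretation tensor: vector_space "scale_tensor :: real \<Rightarrow> ('a, 'n) tensor \<Rightarrow> ('a, 'n) tensor"
  by unfold_locales (auto simp: scale_tensor_def fun_eq_iff algebra_simps)


section \<open>Riemannian metrics and the Levi-Civita connection\<close>

definition metric_form :: "('a, 'n::finite) tensor \<Rightarrow> ('a, 'n) chart \<Rightarrow> 'a \<Rightarrow> real ^ 'n \<Rightarrow> real ^ 'n \<Rightarrow> real" where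
  "metric_form g c x v w = (\<Sum>i\<in>UNIV. \<Sum>j\<in>UNIV. g c x [i, j] * v $ i * w $ j)"

definition riemannian_metric :: "('a, 'n::finite) chart set \<Rightarrow> ('a, 'n) tensor \<Rightarrow> bool" where
  "riemannian_metric A g \<longleftrightarrow>
     g \<in> sym_tensors A 2 \<and> (\<forall>c\<in>A. \<forall>x\<in>cdom c. \<forall>v. v \<noteq> 0 \<longrightarrow> metric_form g c x v v > 0)"

definition inverse_metric :: "('a, 'n::finite) tensor \<Rightarrow> ('a, 'n) chart \<Rightarrow> 'a \<Rightarrow> real ^ 'n ^ 'n" where
  "inverse_metric g c x = matrix_inv (\<chi> i j. g c x [i, j])"

definition christoffel :: "('a, 'n::finite) tensor \<Rightarrow> ('a, 'n) chart \<Rightarrow> 'a \<Rightarrow> 'n \<Rightarrow> 'n \<Rightarrow> 'n \<Rightarrow> real" where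
  "christoffel g c x l k i =
     (\<Sum>m\<in>UNIV. inverse_metric g c x $ l $ m *
        (pd c k (\<lambda>z. g c z [i, m]) x + pd c i (\<lambda>z. g c z [k, m]) x - pd c m (\<lambda>z. g c z [k, i]) x)) / 2"

text \<open>The covariant derivative of \<open>\<alpha>\<close> along the \<open>k\<close>-th coordinate vector, and along any vector.\<close>

definition nabla_coord ::
    "('a, 'n::finite) tensor \<Rightarrow> ('a, 'n) chart \<Rightarrow> 'n \<Rightarrow> ('a, 'n) tensor \<Rightarrow> 'a \<Rightarrow> 'n list \<Rightarrow> real" where
  "nabla_coord g c k \<alpha> x is =
     pd c k (\<lambda>z. \<alpha> c z is) x -
     (\<Sum>j<length is. \<Sum>l\<in>UNIV. christoffel g c x l k (is ! j) * \<alpha> c x (is[j := l]))"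

definition nabla ::
    "('a, 'n::finite) tensor \<Rightarrow> ('a, 'n) chart \<Rightarrow> real ^ 'n \<Rightarrow> ('a, 'n) tensor \<Rightarrow> 'a \<Rightarrow> 'n list \<Rightarrow> real" where
  "nabla g c v \<alpha> x is = (\<Sum>k\<in>UNIV. v $ k * nabla_coord g c k \<alpha> x is)"

text \<open>
  The two properties that characterise the Levi-Civita connection: it is torsion-free and
  the metric is parallel.
\<close>

lemma metric_symmetric:
  assumes "riemannian_metric A g"
  shows "g c x [i, j] = g c x [j, i]"
proof -
  have "mset [i, j] = mset [j, i]"
    by simp
  with assms show ?thesis
    unfolding riemannian_metric_def sym_tensors_def by blast
qed

lemma christoffel_torsion_free:
  assumes "riemannian_metric A g"
  shows "christoffel g c x l k i = christoffel g c x l i k"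
  unfolding christoffel_def by (simp add: metric_symmetric[OF assms, of _ _ k i] add.commute)

lemma metric_form_matrix:
  "metric_form g c x v w = v \<bullet> ((\<chi> i j. g c x [i, j]) *v w)"
  by (simp add: metric_form_def inner_vec_def matrix_vector_mult_def sum_distrib_left mult_ac)

lemma metric_matrix_invertible:
  fixes g :: "('a, 'n::finite) tensor"
  assumes "riemannian_metric A g" "c \<in> A" "x \<in> cdom c"
  shows "invertible ((\<chi> i j. g c x [i, j]) :: real ^ 'n ^ 'n)"
proof -
  have "v = 0" if "(\<chi> i j. g c x [i, j]) *v v = 0" for v :: "real ^ 'n"
  proof -
    have "metric_form g c x v v = 0"
      by (simp add: metric_form_matrix that)
    with assms show ?thesis
      unfolding riemannian_metric_def by (metis less_irrefl)
  qed
  then show ?thesis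
    by (metis invertible_left_inverse matrix_left_invertible_ker)
qed

lemma nabla_metric:
  fixes g :: "('a, 'n::finite) tensor"
  assumes "riemannian_metric A g" "c \<in> A" "x \<in> cdom c"
  shows "nabla g c v g x [i, j] = 0"
proof -
  let ?G = "(\<chi> i j. g c x [i, j]) :: real ^ 'n ^ 'n"
  have inv: "(\<Sum>l\<in>UNIV. g c x [a, l] * inverse_metric g c x $ l $ m) = (if a = m then 1 else 0)" for a m
  proof -
    have "?G ** matrix_inv ?G = mat 1"
      using metric_matrix_invertible[OF assms]
      unfolding matrix_inv_def invertible_def by (rule someI2_ex) blast
    then have "(?G ** matrix_inv ?G) $ a $ m = mat 1 $ a $ m"
      by simp
    then show ?thesis
      by (simp add: matrix_matrix_mult_def mat_def inverse_metric_def)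
  qed
  have low: "(\<Sum>l\<in>UNIV. christoffel g c x l k b * g c x [a, l]) =
      (pd c k (\<lambda>z. g c z [b, a]) x + pd c b (\<lambda>z. g c z [k, a]) x - pd c a (\<lambda>z. g c z [k, b]) x) / 2"
    (is "?lhs = ?D a / 2") for k a b
  proof -
    have "?lhs = (\<Sum>l\<in>UNIV. \<Sum>m\<in>UNIV. (g c x [a, l] * inverse_metric g c x $ l $ m) * ?D m) / 2"
      by (simp add: christoffel_def sum_distrib_left sum_divide_distrib mult_ac)
    also have "\<dots> = (\<Sum>m\<in>UNIV. (\<Sum>l\<in>UNIV. g c x [a, l] * inverse_metric g c x $ l $ m) * ?D m) / 2"
      by (subst sum.swap) (simp add: sum_distrib_right)
    also have "\<dots> = ?D a / 2"
      by (simp add: inv if_distrib[of "\<lambda>t. t * _"] cong: if_cong)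
    finally show ?thesis .
  qed
  have "nabla_coord g c k g x [i, j] = 0" for k
  proof -
    have "(\<Sum>l\<in>UNIV. christoffel g c x l k i * g c x [l, j]) =
        (\<Sum>l\<in>UNIV. christoffel g c x l k i * g c x [j, l])"
      by (intro sum.cong refl arg_cong2[of _ _ _ _ "(*)"] metric_symmetric[OF assms(1)])
    moreover have "(\<lambda>z. g c z [j, i]) = (\<lambda>z. g c z [i, j])"
      by (intro ext metric_symmetric[OF assms(1)])
    ultimately show ?thesis
      by (simp add: nabla_coord_def low lessThan_Suc field_simps)
  qed
  then show ?thesis
    by (simp add: nabla_def)
qed


section \<open>Divergence-free Killing tensors\<close>

definition orthonormal_frame ::
    "('a, 'n::finite) tensor \<Rightarrow> ('a, 'n) chart \<Rightarrow> 'a \<Rightarrow> ('n \<Rightarrow> real ^ 'n) \<Rightarrow> bool" where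
  "orthonormal_frame g c x e \<longleftrightarrow>
     (\<forall>a b. metric_form g c x (e a) (e b) = (if a = b then 1 else 0))"

definition dual_coframe :: "('n \<Rightarrow> real ^ 'n) \<Rightarrow> 'n \<Rightarrow> real ^ 'n::finite" where
  "dual_coframe e = (THE \<theta>. \<forall>a b. \<theta> a \<bullet> e b = (if a = b then 1 else 0))"

text \<open>
  The symmetric product of a covector and a symmetric tensor at a point.  With
  \<open>\<alpha>\<^sub>1 \<cdots> \<alpha>\<^sub>p = \<Sum>\<^sub>\<sigma> \<alpha>\<^bsub>\<sigma>(1)\<^esub> \<otimes> \<cdots> \<otimes> \<alpha>\<^bsub>\<sigma>(p)\<^esub>\<close> the product of \<open>\<theta>\<close> and \<open>T\<close> evaluated on
  \<open>v\<^sub>0, \<dots>, v\<^sub>p\<close> is the sum over \<open>j\<close> of \<open>\<theta>(v\<^sub>j)\<close> times \<open>T\<close> on the remaining vectors, because the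
  permutations can be grouped by the slot \<open>j\<close> in which \<open>\<theta>\<close> stands.
\<close>

definition sym_mult :: "real ^ 'n \<Rightarrow> ('n list \<Rightarrow> real) \<Rightarrow> 'n list \<Rightarrow> real" where
  "sym_mult \<theta> T is = (\<Sum>j<length is. \<theta> $ (is ! j) * T (take j is @ drop (Suc j) is))"

definition interior_product :: "real ^ 'n::finite \<Rightarrow> ('n list \<Rightarrow> real) \<Rightarrow> 'n list \<Rightarrow> real" where
  "interior_product v T is = (\<Sum>k\<in>UNIV. v $ k * T (k # is))"

text \<open>
  Both operators are tensorial in the frame, so that an orthonormal basis at each single point is
  enough, and their values do not depend on its choice.  The degree \<open>p\<close> is that of the argument.
\<close>

definition sym_derivative ::
    "('a, 'n::finite) chart set \<Rightarrow> ('a, 'n) tensor \<Rightarrow> nat \<Rightarrow> ('a, 'n) tensor \<Rightarrow> ('a, 'n) tensor" where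
  "sym_derivative A g p \<alpha> = (\<lambda>c x is.
     if c \<in> A \<and> x \<in> cdom c \<and> length is = Suc p then
       let e = (SOME e. orthonormal_frame g c x e) in
       \<Sum>a\<in>UNIV. sym_mult (dual_coframe e a) (nabla g c (e a) \<alpha> x) is
     else 0)"

definition divergence ::
    "('a, 'n::finite) chart set \<Rightarrow> ('a, 'n) tensor \<Rightarrow> nat \<Rightarrow> ('a, 'n) tensor \<Rightarrow> ('a, 'n) tensor" where
  "divergence A g p \<alpha> = (\<lambda>c x is.
     if c \<in> A \<and> x \<in> cdom c \<and> Suc (length is) = p then
       let e = (SOME e. orthonormal_frame g c x e) in
       - (\<Sum>a\<in>UNIV. interior_product (e a) (nabla g c (e a) \<alpha> x) is)
     else 0)"

definition div_free_killing ::
    "('a, 'n::finite) chart set \<Rightarrow> ('a, 'n) tensor \<Rightarrow> nat \<Rightarrow> ('a, 'n) tensor set" where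
  "div_free_killing A g p =
     {\<alpha> \<in> sym_tensors A p. sym_derivative A g p \<alpha> = 0 \<and> divergence A g p \<alpha> = 0}"

lemma metric_form_bilinear: "bilinear (metric_form g c x)"
  unfolding bilinear_def
  by (auto intro!: linearI simp: metric_form_matrix matrix_vector_right_distrib inner_add_left
      inner_add_right matrix_vector_mult_scaleR)

lemma orthonormal_frame_exists:
  fixes g :: "('a, 'n::finite) tensor"
  assumes g: "riemannian_metric A g" and cx: "c \<in> A" "x \<in> cdom c"
  shows "\<exists>e. orthonormal_frame g c x e"
proof -
  let ?b = "metric_form g c x"
  note bil = metric_form_bilinear[of g c x]
  have sym: "?b v w = ?b w v" for v w
    unfolding metric_form_def
    by (subst sum.swap) (simp add: metric_symmetric[OF g] mult_ac)
  have pos: "?b v v > 0" if "v \<noteq> 0" for v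
    using g cx that unfolding riemannian_metric_def by blast
  define ON where "ON S \<longleftrightarrow> (\<forall>v\<in>S. \<forall>w\<in>S. ?b v w = (if v = w then 1 else 0))" for S
  have "\<exists>S. finite S \<and> card S = k \<and> ON S" if "k \<le> CARD('n)" for k
    using that
  proof (induction k)
    case 0
    show ?case by (intro exI[of _ "{}"]) (simp add: ON_def)
  next
    case (Suc k)
    then obtain S where S: "finite S" "card S = k" "ON S" by auto
    have "dim (span S) \<le> k"
      using dim_le_card'[OF S(1)] S(2) by (simp add: dim_span)
    then have "span S \<noteq> UNIV"
      using Suc.prems by (metis dim_UNIV DIM_cart DIM_real Suc_n_not_le_n mult.right_neutral order_trans)
    then obtain u where u: "u \<notin> span S" by auto
    define w where "w = u - (\<Sum>s\<in>S. ?b u s *\<^sub>R s)"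
    have "(\<Sum>s\<in>S. ?b u s *\<^sub>R s) \<in> span S"
      by (intro span_sum span_scale span_base)
    with u have w0: "w \<noteq> 0"
      unfolding w_def by auto
    have wS: "?b w t = 0" if "t \<in> S" for t
    proof -
      have "?b (\<Sum>s\<in>S. ?b u s *\<^sub>R s) t = (\<Sum>s\<in>S. ?b u s * ?b s t)"
        using bil by (simp add: bilinear_def linear_sum[of "\<lambda>v. ?b v t"] linear_cmul[of "\<lambda>v. ?b v t"])
      also have "\<dots> = (\<Sum>s\<in>S. if s = t then ?b u s else 0)"
        using S(3) that by (intro sum.cong) (auto simp: ON_def)
      also have "\<dots> = ?b u t"
        using S(1) that by simp
      finally show ?thesis
        unfolding w_def by (simp add: bilinear_lsub[OF bil])
    qed
    define v where "v = (1 / sqrt (?b w w)) *\<^sub>R w"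
    have vv: "?b v v = 1"
      using pos[OF w0] by (simp add: v_def bilinear_lmul[OF bil] bilinear_rmul[OF bil] real_sqrt_mult[symmetric] field_simps)
    have vS: "?b v t = 0" "?b t v = 0" if "t \<in> S" for t
      using wS[OF that] sym[of t w] by (simp_all add: v_def bilinear_lmul[OF bil] bilinear_rmul[OF bil])
    have "v \<notin> S"
      using vS vv by force
    then show ?case
      using S vv vS by (intro exI[of _ "insert v S"]) (auto simp: ON_def)
  qed
  from this[OF order_refl] obtain S where S: "finite S" "card S = CARD('n)" "ON S" by blast
  then obtain e :: "'n \<Rightarrow> real ^ 'n" where e: "bij_betw e UNIV S"
    by (metis finite_same_card_bij finite)
  then have "orthonormal_frame g c x e"
    using S(3) unfolding orthonormal_frame_def ON_def bij_betw_def
    by (auto simp: inj_eq)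
  then show ?thesis
    by blast
qed

lemma dual_coframe_orthonormal:
  fixes g :: "('a, 'n::finite) tensor"
  assumes g: "riemannian_metric A g" and cx: "c \<in> A" "x \<in> cdom c" and e: "orthonormal_frame g c x e"
  shows "dual_coframe e a \<bullet> v = metric_form g c x (e a) v"
proof -
  let ?G = "(\<chi> i j. g c x [i, j]) :: real ^ 'n ^ 'n"
  define E where "E = ((\<chi> b i. e b $ i) :: real ^ 'n ^ 'n)"
  have sym: "metric_form g c x v w = metric_form g c x w v" for v w
    unfolding metric_form_def
    by (subst sum.swap) (simp add: metric_symmetric[OF g] mult_ac)
  have row: "(E *v w) $ b = w \<bullet> e b" for w b
    by (simp add: E_def matrix_vector_mult_def inner_vec_def mult_ac)
  have "E ** (?G ** transpose E) = mat 1"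
  proof -
    have "(E ** (?G ** transpose E)) $ p $ q = metric_form g c x (e p) (e q)" for p q
      by (simp add: E_def matrix_matrix_mult_def transpose_def metric_form_matrix inner_vec_def
          matrix_vector_mult_def)
    then show ?thesis
      using e by (simp add: vec_eq_iff orthonormal_frame_def mat_def)
  qed
  then have "invertible E"
    using invertible_right_inverse by blast
  then have inj: "w = w'" if "E *v w = E *v w'" for w w'
    by (metis that invertible_def matrix_vector_mul_assoc matrix_vector_mul_lid)
  have flat: "(?G *v e p) \<bullet> w = metric_form g c x (e p) w" for p w
    by (subst sym) (simp add: metric_form_matrix inner_commute)
  have "dual_coframe e = (\<lambda>p. ?G *v e p)"
    unfolding dual_coframe_def
  proof (rule the_equality)
    show "\<forall>p q. (?G *v e p) \<bullet> e q = (if p = q then 1 else 0)"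
      using e by (simp add: flat orthonormal_frame_def)
    fix \<theta> assume \<theta>: "\<forall>p q. \<theta> p \<bullet> e q = (if p = q then 1 else 0)"
    show "\<theta> = (\<lambda>p. ?G *v e p)"
    proof
      fix p
      have "E *v \<theta> p = E *v (?G *v e p)"
        using e \<theta> by (simp add: vec_eq_iff row flat orthonormal_frame_def)
      then show "\<theta> p = ?G *v e p"
        by (rule inj)
    qed
  qed
  then show ?thesis
    by (simp add: flat)
qed


section \<open>Adapted metrics and the dimension bound\<close>

text \<open>
  The negative directions may be any \<open>m\<close> of the coordinates instead of the first \<open>m\<close>, since the
  index type carries no order; this amounts to a permutation of the coordinates.  The metric
  \<open>(dy\<^sub>1)\<^sup>2 + \<dots> + (dy\<^sub>n)\<^sup>2\<close> is the Euclidean one, with components \<open>\<delta>\<^bsub>ij\<^esub>\<close>.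
\<close>

definition adapted_metric :: "'a topology \<Rightarrow> ('a, 'n::finite) chart set \<Rightarrow> ('a \<Rightarrow> real) \<Rightarrow> ('a, 'n) tensor \<Rightarrow> bool" where
  "adapted_metric M A f g \<longleftrightarrow>
     (\<forall>x. critical_point M A f x \<longrightarrow>
       (\<exists>c\<in>A. \<exists>N. x \<in> cdom c \<and> card N = morse_index A f x \<and> coord c x = 0 \<and>
         (\<forall>z\<in>cdom c.
            f z = f x - (\<Sum>k\<in>N. (coord c z $ k)\<^sup>2) / 2 + (\<Sum>k\<in>-N. (coord c z $ k)\<^sup>2) / 2 \<and>
            (\<forall>i j. g c z [i, j] = (if i = j then 1 else 0)))))"

definition K0_2 :: "nat \<Rightarrow> real" where
  "K0_2 n =
     (if n = 1 then 1
      else if n = 2 then 3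
      else 1 / real n * real ((n + 2) choose 3) * real ((n + 1) choose 2) - real n * (real n + 3) / 2)"

end

theory Submission
  imports Defs
begin

text \<open>
  A Killing 2-tensor on a connected manifold is determined by its value and its first and second
  derivatives at a single point, and at a point around which the metric is flat these derivatives
  are constrained by linear equations whose solution space has dimension at most \<open>K0_2 n\<close>.  The Morse
  function supplies such a point: around its minimum an adapted metric is Euclidean.

  Determination by the 2-jet rests on two facts.  In coordinates the Killing equation expresses the
  cyclic sum \<open>\<partial>\<^sub>i \<alpha>\<^sub>j\<^sub>k + \<partial>\<^sub>j \<alpha>\<^sub>i\<^sub>k + \<partial>\<^sub>k \<alpha>\<^sub>i\<^sub>j\<close> by the \<open>\<alpha>\<^sub>p\<^sub>q\<close> themselves, with smooth coefficients.
  After two more differentiations these equations can be solved for all third derivatives of \<open>\<alpha>\<close>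
  (\<open>third_derivatives_from_killing\<close>), so that \<open>\<alpha>\<close> and its derivatives of order at most two form
  a closed linear first-order system.  By Gronwall's inequality a solution of such a system that
  vanishes at one point of a convex set vanishes on all of it (\<open>finite_type_unique_continuation\<close>).
  Hence the set of points near which \<open>\<alpha>\<close> vanishes is open and closed
  (\<open>killing_eq_0_if_jet_eq_0\<close>).

  Where the metric is Euclidean, the Christoffel symbols vanish, and a divergence-free Killing tensor
  has constant trace.  Its derivatives of order 0, 1 and 2 at the point therefore lie in the following
  spaces: symmetric 2-tensors; tensors in \<open>V \<otimes> Sym\<^sup>2 V\<close> without cyclic sum and without trace
  (\<open>first_jets\<close>); tensors in \<open>Sym\<^sup>2 V \<otimes> Sym\<^sup>2 V\<close> without cyclic sum and without trace, a copy of
  the space of Weyl tensors (\<open>second_jets\<close>).  The last two are annihilators of the image of a linear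
  map, the transpose of the constraints.  This map is injective on certain spaces of tensors with
  prescribed symmetries, whose dimensions are therefore lower bounds for its rank; counting index
  orbits gives a total of \<open>K0_2 n\<close> (\<open>jet_dimension_bound\<close>).  In dimensions 1 and 2 the trace
  conditions are partly redundant, which is why \<open>K0_2\<close> is given there by separate values.
\<close>

section \<open>Calculus of smooth functions\<close>

definition dir_deriv :: "'a \<Rightarrow> ('a::real_normed_vector \<Rightarrow> 'b::real_normed_vector) \<Rightarrow> 'a \<Rightarrow> 'b" where
  "dir_deriv v f x = frechet_derivative f (at x) v"

lemma C_times_Suc:
  "C_times (Suc k) S f \<longleftrightarrow> (\<forall>x\<in>S. f differentiable (at x)) \<and> (\<forall>v. C_times k S (dir_deriv v f))"
  by (simp add: dir_deriv_def[abs_def])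

text \<open>With \<open>C_times_Suc\<close> as the unfolding rule, derivatives stay in a form that the calculus rules below match.\<close>

declare C_times.simps(2)[simp del]

text \<open>
  If neither function has a derivative at \<open>x\<close>, both sides are the same arbitrary choice.
\<close>

lemma frechet_derivative_cong_open:
  assumes "open S" "x \<in> S" "\<And>y. y \<in> S \<Longrightarrow> f y = g y"
  shows "frechet_derivative f (at x) = frechet_derivative g (at x)"
proof -
  have "(f has_derivative F) (at x) \<longleftrightarrow> (g has_derivative F) (at x)" for F
    using has_derivative_transform_within_open[OF _ assms(1,2)] assms(3) by metis
  then show ?thesis
    unfolding frechet_derivative_def by simp
qed

lemma dir_deriv_cong:
  assumes "open S" "x \<in> S" "\<And>y. y \<in> S \<Longrightarrow> f y = g y"
  shows "dir_deriv v f x = dir_deriv v g x"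
  unfolding dir_deriv_def by (simp add: frechet_derivative_cong_open[OF assms])

lemma C_times_cong:
  assumes "open S" "\<And>y. y \<in> S \<Longrightarrow> f y = g y"
  shows "C_times k S f \<longleftrightarrow> C_times k S g"
  using assms(2)
proof (induction k arbitrary: f g)
  case 0
  then show ?case by (simp cong: continuous_on_cong)
next
  case (Suc k)
  have "f differentiable at x \<longleftrightarrow> g differentiable at x" if "x \<in> S" for x
    unfolding differentiable_def
    using has_derivative_transform_within_open[OF _ \<open>open S\<close> that] Suc.prems by metis
  moreover have "C_times k S (dir_deriv v f) \<longleftrightarrow> C_times k S (dir_deriv v g)" for v
    by (intro Suc.IH dir_deriv_cong[OF \<open>open S\<close>] Suc.prems)
  ultimately show ?case by (auto simp: C_times_Suc)
qed

lemma C_times_Suc_imp: "C_times (Suc k) S f \<Longrightarrow> C_times k S f"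
proof (induction k arbitrary: f)
  case 0
  then show ?case
    by (auto simp: C_times_Suc intro!: continuous_at_imp_continuous_on differentiable_imp_continuous_within)
next
  case (Suc k)
  then show ?case
    using C_times_Suc by blast
qed

lemma smooth_on_cong:
  assumes "open S" "\<And>y. y \<in> S \<Longrightarrow> f y = g y"
  shows "smooth_on S f \<longleftrightarrow> smooth_on S g"
  unfolding smooth_on_def using C_times_cong[of S f g, OF assms] by simp

lemma smooth_on_continuous: "smooth_on S f \<Longrightarrow> continuous_on S f"
  unfolding smooth_on_def using C_times.simps(1) by blast

lemma smooth_on_differentiable: "smooth_on S f \<Longrightarrow> x \<in> S \<Longrightarrow> f differentiable (at x)"
  unfolding smooth_on_def using C_times_Suc by blast

lemma smooth_on_dir_deriv: "smooth_on S f \<Longrightarrow> smooth_on S (dir_deriv v f)"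
  unfolding smooth_on_def using C_times_Suc by blast

lemma dir_deriv_eqI: "(f has_derivative F) (at x) \<Longrightarrow> dir_deriv v f x = F v"
  unfolding dir_deriv_def using frechet_derivative_at by metis

lemma dir_deriv_const: "dir_deriv v (\<lambda>x. c) = (\<lambda>x. 0)"
  by (rule ext) (rule dir_deriv_eqI, rule has_derivative_const)

lemma C_times_const: "C_times k S (\<lambda>x. c)"
  by (induction k arbitrary: c) (auto simp: C_times_Suc dir_deriv_const)

lemma differentiable_has_dir_deriv:
  "f differentiable (at x) \<Longrightarrow> (f has_derivative (\<lambda>v. dir_deriv v f x)) (at x)"
  unfolding dir_deriv_def using frechet_derivative_works by blast

lemma dir_deriv_add:
  "f differentiable (at x) \<Longrightarrow> g differentiable (at x) \<Longrightarrow>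
     dir_deriv v (\<lambda>x. f x + g x) x = dir_deriv v f x + dir_deriv v g x"
  by (rule dir_deriv_eqI) (intro has_derivative_add differentiable_has_dir_deriv)

lemma dir_deriv_mult:
  fixes f g :: "'a::real_normed_vector \<Rightarrow> real"
  shows "f differentiable (at x) \<Longrightarrow> g differentiable (at x) \<Longrightarrow>
     dir_deriv v (\<lambda>x. f x * g x) x = f x * dir_deriv v g x + dir_deriv v f x * g x"
  by (rule dir_deriv_eqI) (intro has_derivative_mult differentiable_has_dir_deriv)

lemma dir_deriv_cmult:
  fixes f :: "'a::real_normed_vector \<Rightarrow> real"
  assumes "f differentiable (at x)"
  shows "dir_deriv v (\<lambda>x. r * f x) x = r * dir_deriv v f x"
  by (rule dir_deriv_eqI) (intro has_derivative_mult_right differentiable_has_dir_deriv assms)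

lemma dir_deriv_inverse:
  fixes f :: "'a::real_normed_vector \<Rightarrow> real"
  shows "f differentiable (at x) \<Longrightarrow> f x \<noteq> 0 \<Longrightarrow>
     dir_deriv v (\<lambda>x. inverse (f x)) x = - (inverse (f x) * dir_deriv v f x * inverse (f x))"
  by (rule dir_deriv_eqI) (rule Deriv.has_derivative_inverse[OF _ differentiable_has_dir_deriv])

lemma C_times_add:
  assumes "open S"
  shows "C_times k S f \<Longrightarrow> C_times k S g \<Longrightarrow> C_times k S (\<lambda>x. f x + g x)"
proof (induction k arbitrary: f g)
  case 0
  then show ?case by (simp add: continuous_on_add)
next
  case (Suc k)
  have "C_times k S (dir_deriv v (\<lambda>x. f x + g x))" for v
  proof -
    have "C_times k S (\<lambda>x. dir_deriv v f x + dir_deriv v g x)"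
      using Suc by (intro Suc.IH) (auto simp: C_times_Suc)
    then show ?thesis
      using Suc.prems by (subst C_times_cong[OF assms]) (auto simp: C_times_Suc dir_deriv_add)
  qed
  then show ?case
    using Suc.prems by (auto simp: C_times_Suc)
qed

lemma C_times_mult:
  fixes f g :: "'a::real_normed_vector \<Rightarrow> real"
  assumes "open S"
  shows "C_times k S f \<Longrightarrow> C_times k S g \<Longrightarrow> C_times k S (\<lambda>x. f x * g x)"
proof (induction k arbitrary: f g)
  case 0
  then show ?case by (simp add: continuous_on_mult)
next
  case (Suc k)
  have "C_times k S (dir_deriv v (\<lambda>x. f x * g x))" for v
  proof -
    have "C_times k S (\<lambda>x. f x * dir_deriv v g x + dir_deriv v f x * g x)"
      using Suc.prems
      by (intro Suc.IH C_times_add[OF assms]) (auto simp: C_times_Suc C_times_Suc_imp)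
    then show ?thesis
      using Suc.prems by (subst C_times_cong[OF assms]) (auto simp: C_times_Suc dir_deriv_mult)
  qed
  then show ?case
    using Suc.prems by (auto simp: C_times_Suc)
qed

lemma C_times_inverse:
  fixes f :: "'a::real_normed_vector \<Rightarrow> real"
  assumes "open S" "\<And>x. x \<in> S \<Longrightarrow> f x \<noteq> 0"
  shows "C_times k S f \<Longrightarrow> C_times k S (\<lambda>x. inverse (f x))"
proof (induction k)
  case 0
  then show ?case using assms by (auto intro!: continuous_on_inverse)
next
  case (Suc k)
  have "C_times k S (dir_deriv v (\<lambda>x. inverse (f x)))" for v
  proof -
    have "C_times k S (\<lambda>x. (-1) * (inverse (f x) * dir_deriv v f x * inverse (f x)))"
      using Suc.prems Suc.IH C_times_Suc_imp[OF Suc.prems]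
      by (intro C_times_mult[OF assms(1)] C_times_const) (auto simp: C_times_Suc)
    then show ?thesis
      using Suc.prems assms by (subst C_times_cong[OF assms(1)]) (auto simp: C_times_Suc dir_deriv_inverse)
  qed
  then show ?case
    using Suc.prems assms by (auto simp: C_times_Suc)
qed

lemma smooth_on_const: "smooth_on S (\<lambda>x. c)"
  by (simp add: smooth_on_def C_times_const)

lemma smooth_on_add: "open S \<Longrightarrow> smooth_on S f \<Longrightarrow> smooth_on S g \<Longrightarrow> smooth_on S (\<lambda>x. f x + g x)"
  by (simp add: smooth_on_def C_times_add)

lemma smooth_on_mult:
  fixes f g :: "'a::real_normed_vector \<Rightarrow> real"
  shows "open S \<Longrightarrow> smooth_on S f \<Longrightarrow> smooth_on S g \<Longrightarrow> smooth_on S (\<lambda>x. f x * g x)"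
  by (simp add: smooth_on_def C_times_mult)

lemma smooth_on_diff:
  fixes f g :: "'a::real_normed_vector \<Rightarrow> real"
  assumes "open S" "smooth_on S f" "smooth_on S g"
  shows "smooth_on S (\<lambda>x. f x - g x)"
  using smooth_on_add[OF assms(1,2) smooth_on_mult[OF assms(1) smooth_on_const[of _ "-1"] assms(3)]]
  by simp

lemma smooth_on_divide:
  fixes f g :: "'a::real_normed_vector \<Rightarrow> real"
  assumes "open S" "smooth_on S f" "smooth_on S g" "\<And>x. x \<in> S \<Longrightarrow> g x \<noteq> 0"
  shows "smooth_on S (\<lambda>x. f x / g x)"
  using assms unfolding divide_inverse smooth_on_def by (auto intro!: C_times_mult C_times_inverse)

lemma smooth_on_sum:
  fixes f :: "'i \<Rightarrow> 'a::real_normed_vector \<Rightarrow> real"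
  assumes "open S" "\<And>i. i \<in> I \<Longrightarrow> smooth_on S (f i)"
  shows "smooth_on S (\<lambda>x. \<Sum>i\<in>I. f i x)"
  using assms(2)
  by (induction I rule: infinite_finite_induct) (auto intro: smooth_on_const smooth_on_add[OF assms(1)])

lemma smooth_on_prod:
  fixes f :: "'i \<Rightarrow> 'a::real_normed_vector \<Rightarrow> real"
  assumes "open S" "\<And>i. i \<in> I \<Longrightarrow> smooth_on S (f i)"
  shows "smooth_on S (\<lambda>x. \<Prod>i\<in>I. f i x)"
  using assms(2)
  by (induction I rule: infinite_finite_induct) (auto intro: smooth_on_const smooth_on_mult[OF assms(1)])

lemma smooth_on_det:
  fixes F :: "'n::finite \<Rightarrow> 'n \<Rightarrow> 'a::real_normed_vector \<Rightarrow> real"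
  assumes "open S" "\<And>i j. smooth_on S (F i j)"
  shows "smooth_on S (\<lambda>x. det (\<chi> i j. F i j x))"
  unfolding det_def
  by (auto intro!: smooth_on_sum smooth_on_mult smooth_on_prod smooth_on_const assms)

lemma matrix_inv_cramer:
  fixes G :: "real^'n^'n"
  assumes "invertible G"
  shows "matrix_inv G $ l $ m = det (\<chi> i j. if j = l then axis m 1 $ i else G $ i $ j) / det G"
proof -
  have "G ** matrix_inv G = mat 1"
    using assms unfolding matrix_inv_def invertible_def by (rule someI2_ex) blast
  then have "G *v (matrix_inv G *v axis m 1) = axis m 1"
    by (simp add: matrix_vector_mul_assoc)
  then have "matrix_inv G *v axis m 1 =
      (\<chi> k. det(\<chi> i j. if j=k then axis m 1 $ i else G$i$j) / det G)"
    using cramer assms invertible_det_nz by blast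
  moreover have "(matrix_inv G *v axis m 1) $ l = matrix_inv G $ l $ m"
    by (simp add: matrix_vector_mul_component inner_axis)
  ultimately show ?thesis by simp
qed

text \<open>
  By Cramer's rule the entries of the inverse are quotients of determinants, so the inverse metric
  and hence the Christoffel symbols are smooth.
\<close>

lemma smooth_on_matrix_inv:
  fixes F :: "'n::finite \<Rightarrow> 'n \<Rightarrow> 'a::real_normed_vector \<Rightarrow> real"
  assumes "open S" "\<And>i j. smooth_on S (F i j)" "\<And>x. x \<in> S \<Longrightarrow> invertible ((\<chi> i j. F i j x) :: real^'n^'n)"
  shows "smooth_on S (\<lambda>x. matrix_inv ((\<chi> i j. F i j x) :: real^'n^'n) $ l $ m)"
proof -
  have "smooth_on S (\<lambda>x. if j = l then axis m 1 $ i else F i j x)" for i j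
    by (cases "j = l") (simp_all add: assms smooth_on_const)
  then have "smooth_on S (\<lambda>x. det ((\<chi> i j. if j = l then axis m 1 $ i else F i j x) :: real^'n^'n)
      / det ((\<chi> i j. F i j x) :: real^'n^'n))"
    using assms
    by (intro smooth_on_divide smooth_on_det)
       (auto simp: invertible_det_nz)
  then show ?thesis
    by (subst smooth_on_cong[OF assms(1)]) (auto simp: matrix_inv_cramer assms(3) cong: if_cong)
qed

section \<open>Symmetry of second derivatives\<close>

lemma has_real_derivative_along_line:
  fixes f :: "'a::real_normed_vector \<Rightarrow> real"
  assumes "f differentiable (at (p + a *\<^sub>R u))"
  shows "((\<lambda>a. f (p + a *\<^sub>R u)) has_real_derivative dir_deriv u f (p + a *\<^sub>R u)) (at a)"
proof -
  have 1: "((\<lambda>a. p + a *\<^sub>R u) has_derivative (\<lambda>h. h *\<^sub>R u)) (at a)"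
    by (auto intro!: derivative_eq_intros)
  have 2: "(f has_derivative (\<lambda>v. dir_deriv v f (p + a *\<^sub>R u))) (at (p + a *\<^sub>R u))"
    by (rule differentiable_has_dir_deriv[OF assms])
  from has_derivative_compose[OF 1 2]
  have "((\<lambda>a. f (p + a *\<^sub>R u)) has_derivative (\<lambda>h. dir_deriv (h *\<^sub>R u) f (p + a *\<^sub>R u))) (at a)" .
  moreover have "dir_deriv (h *\<^sub>R u) f (p + a *\<^sub>R u) = dir_deriv u f (p + a *\<^sub>R u) * h" for h
    using linear_cmul[OF has_derivative_linear[OF 2], of h u] by simp
  ultimately show ?thesis
    by (simp add: has_field_derivative_def)
qed

text \<open>
  The second difference is symmetric in \<open>u\<close> and \<open>v\<close>, but applying the mean value theorem along
  \<open>u\<close> and then along \<open>v\<close> produces the mixed derivative in one particular order.  Comparing the two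
  orders gives the symmetry of second derivatives.
\<close>

lemma second_difference_mean_value:
  fixes f :: "'a::real_normed_vector \<Rightarrow> real"
  assumes S: "smooth_on (ball x r) f" and s: "s > 0" "s * (norm u + norm v) < r"
  obtains p where "p \<in> ball x r"
    "f (x + s *\<^sub>R u + s *\<^sub>R v) - f (x + s *\<^sub>R u) - f (x + s *\<^sub>R v) + f x = s\<^sup>2 * dir_deriv v (dir_deriv u f) p"
proof -
  have mem: "x + a *\<^sub>R u + b *\<^sub>R v \<in> ball x r" if "0 \<le> a" "a \<le> s" "0 \<le> b" "b \<le> s" for a b
  proof -
    have "norm (a *\<^sub>R u + b *\<^sub>R v) \<le> a * norm u + b * norm v"
      using that norm_triangle_ineq[of "a *\<^sub>R u" "b *\<^sub>R v"] by simp
    also have "\<dots> \<le> s * norm u + s * norm v"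
      using that by (intro add_mono mult_right_mono) auto
    finally show ?thesis
      using s(2) by (simp add: dist_norm algebra_simps norm_minus_commute)
  qed
  let ?\<phi> = "\<lambda>a. f (x + s *\<^sub>R v + a *\<^sub>R u) - f (x + a *\<^sub>R u)"
  have "(?\<phi> has_real_derivative dir_deriv u f (x + s *\<^sub>R v + a *\<^sub>R u) - dir_deriv u f (x + a *\<^sub>R u)) (at a)"
    if "0 \<le> a" "a \<le> s" for a
    using mem[OF that, of s] mem[OF that, of 0] s
    by (intro DERIV_diff has_real_derivative_along_line smooth_on_differentiable[OF S]) (auto simp: algebra_simps)
  from MVT2[OF s(1) this] obtain a where a: "0 < a" "a < s"
    "?\<phi> s - ?\<phi> 0 = (s - 0) * (dir_deriv u f (x + s *\<^sub>R v + a *\<^sub>R u) - dir_deriv u f (x + a *\<^sub>R u))" by auto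
  have "((\<lambda>b. dir_deriv u f (x + a *\<^sub>R u + b *\<^sub>R v)) has_real_derivative dir_deriv v (dir_deriv u f) (x + a *\<^sub>R u + b *\<^sub>R v)) (at b)"
    if "0 \<le> b" "b \<le> s" for b
    using mem[of a b] that a
    by (intro has_real_derivative_along_line smooth_on_differentiable[OF smooth_on_dir_deriv[OF S]]) auto
  from MVT2[OF s(1) this] obtain b where b: "0 < b" "b < s"
    "dir_deriv u f (x + a *\<^sub>R u + s *\<^sub>R v) - dir_deriv u f (x + a *\<^sub>R u + 0 *\<^sub>R v)
       = (s - 0) * dir_deriv v (dir_deriv u f) (x + a *\<^sub>R u + b *\<^sub>R v)" by auto
  show ?thesis
  proof
    show "x + a *\<^sub>R u + b *\<^sub>R v \<in> ball x r" using mem a b by simp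
    show "f (x + s *\<^sub>R u + s *\<^sub>R v) - f (x + s *\<^sub>R u) - f (x + s *\<^sub>R v) + f x
        = s\<^sup>2 * dir_deriv v (dir_deriv u f) (x + a *\<^sub>R u + b *\<^sub>R v)"
      using a(3) b(3) by (simp add: power2_eq_square algebra_simps)
  qed
qed

lemma smooth_on_subset: "smooth_on S f \<Longrightarrow> T \<subseteq> S \<Longrightarrow> smooth_on T f"
proof -
  have "C_times k S f \<Longrightarrow> T \<subseteq> S \<Longrightarrow> C_times k T f" for k
  proof (induction k arbitrary: f)
    case 0 then show ?case by (auto intro: continuous_on_subset)
  next
    case (Suc k) then show ?case by (auto simp: C_times_Suc)
  qed
  then show "smooth_on S f \<Longrightarrow> T \<subseteq> S \<Longrightarrow> smooth_on T f"
    unfolding smooth_on_def by blast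
qed

lemma second_dir_deriv_commute_le:
  fixes f :: "'a::real_normed_vector \<Rightarrow> real"
  assumes "open S" "smooth_on S f" "x \<in> S"
  shows "dir_deriv u (dir_deriv v f) x \<le> dir_deriv v (dir_deriv u f) x"
proof (rule ccontr)
  assume "\<not> ?thesis"
  then obtain m where m: "dir_deriv v (dir_deriv u f) x < m" "m < dir_deriv u (dir_deriv v f) x"
    using dense not_le by blast
  have cont: "isCont (dir_deriv v (dir_deriv u f)) x" "isCont (dir_deriv u (dir_deriv v f)) x"
    using assms by (auto intro!: continuous_on_interior smooth_on_continuous smooth_on_dir_deriv simp: interior_open)
  have "\<forall>\<^sub>F y in nhds x. dir_deriv v (dir_deriv u f) y < m" "\<forall>\<^sub>F y in nhds x. dir_deriv u (dir_deriv v f) y > m"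
    using cont m unfolding isCont_def tendsto_at_iff_tendsto_nhds
    by (auto dest: order_tendstoD)
  moreover have "\<forall>\<^sub>F y in nhds x. y \<in> S"
    using assms by (simp add: eventually_nhds_in_open)
  ultimately have "\<forall>\<^sub>F y in nhds x. y \<in> S \<and> dir_deriv v (dir_deriv u f) y < m \<and> dir_deriv u (dir_deriv v f) y > m"
    by eventually_elim simp
  then obtain r where r: "r > 0"
    "\<And>y. dist y x < r \<Longrightarrow> y \<in> S \<and> dir_deriv v (dir_deriv u f) y < m \<and> dir_deriv u (dir_deriv v f) y > m"
    unfolding eventually_nhds_metric by blast
  then have sm: "smooth_on (ball x r) f"
    by (intro smooth_on_subset[OF assms(2)]) (auto simp: dist_commute)
  \<comment> \<open>So small that the parallelogram spanned by \<open>s u\<close> and \<open>s v\<close> at \<open>x\<close> stays in the ball, also for \<open>u = v = 0\<close>.\<close>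
  define s where "s = r / (2 * (norm u + norm v + 1))"
  have pos: "norm u + norm v + 1 > 0"
    by (simp add: add_nonneg_pos)
  then have s0: "s > 0" using r by (simp add: s_def)
  have "s * (norm u + norm v) < s * (2 * (norm u + norm v + 1))"
    using s0 by (intro mult_strict_left_mono) (auto simp: add_nonneg_pos intro: add_strict_increasing2)
  also have "\<dots> = r"
    using pos by (simp add: s_def)
  finally have sr: "s * (norm u + norm v) < r" .
  obtain p where p: "p \<in> ball x r"
    "f (x + s *\<^sub>R u + s *\<^sub>R v) - f (x + s *\<^sub>R u) - f (x + s *\<^sub>R v) + f x = s\<^sup>2 * dir_deriv v (dir_deriv u f) p"
    using second_difference_mean_value[OF sm s0 sr] .
  obtain q where q: "q \<in> ball x r"
    "f (x + s *\<^sub>R v + s *\<^sub>R u) - f (x + s *\<^sub>R v) - f (x + s *\<^sub>R u) + f x = s\<^sup>2 * dir_deriv u (dir_deriv v f) q"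
    using second_difference_mean_value[OF sm s0, of v u] sr by (auto simp: add.commute)
  have "s\<^sup>2 * dir_deriv v (dir_deriv u f) p = s\<^sup>2 * dir_deriv u (dir_deriv v f) q"
    using p(2) q(2) by (simp add: algebra_simps)
  then have "dir_deriv v (dir_deriv u f) p = dir_deriv u (dir_deriv v f) q"
    using s0 by simp
  then show False
    using r(2)[of p] r(2)[of q] p(1) q(1) by (auto simp: dist_commute)
qed

lemma second_dir_deriv_commute:
  fixes f :: "'a::real_normed_vector \<Rightarrow> real"
  assumes "open S" "smooth_on S f" "x \<in> S"
  shows "dir_deriv u (dir_deriv v f) x = dir_deriv v (dir_deriv u f) x"
  using second_dir_deriv_commute_le[OF assms] by (simp add: antisym)

section \<open>Differential systems of finite type\<close>

text \<open>
  Membership in the module generated by \<open>G\<close> over the ring of smooth functions on \<open>U\<close>.  It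
  records that a function depends linearly on the generators without naming the coefficients.
\<close>

definition smooth_combination :: "'a::real_normed_vector set \<Rightarrow> ('a \<Rightarrow> real) set \<Rightarrow> ('a \<Rightarrow> real) \<Rightarrow> bool" where
  "smooth_combination U G \<phi> \<longleftrightarrow>
     (\<exists>m. (\<forall>g\<in>G. smooth_on U (m g)) \<and> (\<forall>y\<in>U. \<phi> y = (\<Sum>g\<in>G. m g y * g y)))"

lemma smooth_combination_cong:
  "(\<And>y. y \<in> U \<Longrightarrow> \<phi> y = \<psi> y) \<Longrightarrow> smooth_combination U G \<phi> \<longleftrightarrow> smooth_combination U G \<psi>"
  by (simp add: smooth_combination_def)

lemma smooth_combination_zero: "smooth_combination U G (\<lambda>y. 0)"
  unfolding smooth_combination_def by (intro exI[of _ "\<lambda>_ _. 0"]) (simp add: smooth_on_const)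

lemma smooth_combination_base:
  assumes "finite G" "g \<in> G"
  shows "smooth_combination U G g"
  unfolding smooth_combination_def
  by (intro exI[of _ "\<lambda>h y. if h = g then 1 else 0"])
     (use assms in \<open>auto simp: smooth_on_const if_distrib[of "\<lambda>t. t * _"] cong: if_cong\<close>)

lemma smooth_combination_add:
  assumes "open U" "smooth_combination U G \<phi>" "smooth_combination U G \<psi>"
  shows "smooth_combination U G (\<lambda>y. \<phi> y + \<psi> y)"
proof -
  from assms obtain m m' where
    "\<forall>g\<in>G. smooth_on U (m g)" "\<forall>y\<in>U. \<phi> y = (\<Sum>g\<in>G. m g y * g y)"
    "\<forall>g\<in>G. smooth_on U (m' g)" "\<forall>y\<in>U. \<psi> y = (\<Sum>g\<in>G. m' g y * g y)"
    unfolding smooth_combination_def by blast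
  then show ?thesis
    unfolding smooth_combination_def
    by (intro exI[of _ "\<lambda>g y. m g y + m' g y"])
       (auto simp: distrib_right sum.distrib intro: smooth_on_add[OF assms(1)])
qed

lemma smooth_combination_mult:
  assumes "open U" "smooth_on U a" "smooth_combination U G \<phi>"
  shows "smooth_combination U G (\<lambda>y. a y * \<phi> y)"
proof -
  from assms obtain m where
    "\<forall>g\<in>G. smooth_on U (m g)" "\<forall>y\<in>U. \<phi> y = (\<Sum>g\<in>G. m g y * g y)"
    unfolding smooth_combination_def by blast
  then show ?thesis
    unfolding smooth_combination_def
    by (intro exI[of _ "\<lambda>g y. a y * m g y"])
       (auto simp: sum_distrib_left mult.assoc intro: smooth_on_mult[OF assms(1,2)])
qed

lemma smooth_combination_cmult: "open U \<Longrightarrow> smooth_combination U G \<phi> \<Longrightarrow> smooth_combination U G (\<lambda>y. c * \<phi> y)"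
  by (rule smooth_combination_mult[OF _ smooth_on_const])

lemma smooth_combination_diff:
  "open U \<Longrightarrow> smooth_combination U G \<phi> \<Longrightarrow> smooth_combination U G \<psi> \<Longrightarrow> smooth_combination U G (\<lambda>y. \<phi> y - \<psi> y)"
  using smooth_combination_add[of U G \<phi> "\<lambda>y. (-1) * \<psi> y"] smooth_combination_cmult[of U G \<psi> "-1"] by simp

lemma smooth_combination_sum:
  assumes "open U" "\<And>i. i \<in> I \<Longrightarrow> smooth_combination U G (\<phi> i)"
  shows "smooth_combination U G (\<lambda>y. \<Sum>i\<in>I. \<phi> i y)"
  using assms(2)
  by (induction I rule: infinite_finite_induct) (auto intro: smooth_combination_zero smooth_combination_add[OF assms(1)])

definition prolongation :: "(real^'n::finite \<Rightarrow> real) set \<Rightarrow> (real^'n \<Rightarrow> real) set" where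
  "prolongation G = G \<union> (\<Union>k. dir_deriv (axis k 1) ` G)"

lemma finite_prolongation: "finite G \<Longrightarrow> finite (prolongation G)"
  by (simp add: prolongation_def)

lemma smooth_on_prolongation:
  "(\<And>g. g \<in> G \<Longrightarrow> smooth_on U g) \<Longrightarrow> g \<in> prolongation G \<Longrightarrow> smooth_on U g"
  by (auto simp: prolongation_def smooth_on_dir_deriv)

lemma dir_deriv_sum:
  fixes f :: "'i \<Rightarrow> 'a::real_normed_vector \<Rightarrow> real"
  assumes "\<And>i. i \<in> I \<Longrightarrow> f i differentiable (at x)"
  shows "dir_deriv v (\<lambda>x. \<Sum>i\<in>I. f i x) x = (\<Sum>i\<in>I. dir_deriv v (f i) x)"
  by (rule dir_deriv_eqI) (intro has_derivative_sum differentiable_has_dir_deriv assms)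

lemma smooth_combination_dir_deriv:
  assumes U: "open U" and G: "finite G" "\<And>g. g \<in> G \<Longrightarrow> smooth_on U g"
    and \<phi>: "smooth_combination U G \<phi>"
  shows "smooth_combination U (prolongation G) (dir_deriv (axis k 1) \<phi>)"
proof -
  from \<phi> obtain m where m: "\<And>g. g \<in> G \<Longrightarrow> smooth_on U (m g)"
    "\<And>y. y \<in> U \<Longrightarrow> \<phi> y = (\<Sum>g\<in>G. m g y * g y)"
    unfolding smooth_combination_def by blast
  let ?D = "dir_deriv (axis k 1)"
  have "?D \<phi> y = (\<Sum>g\<in>G. m g y * ?D g y + ?D (m g) y * g y)" if y: "y \<in> U" for y
  proof -
    have "?D \<phi> y = ?D (\<lambda>y. \<Sum>g\<in>G. m g y * g y) y"
      by (rule dir_deriv_cong[OF U y m(2)])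
    also have "\<dots> = (\<Sum>g\<in>G. ?D (\<lambda>y. m g y * g y) y)"
      by (intro dir_deriv_sum smooth_on_differentiable[OF _ y] smooth_on_mult[OF U] m G(2))
    also have "\<dots> = (\<Sum>g\<in>G. m g y * ?D g y + ?D (m g) y * g y)"
      by (intro sum.cong refl dir_deriv_mult smooth_on_differentiable[OF _ y] m G(2))
    finally show ?thesis .
  qed
  moreover have "smooth_combination U (prolongation G) (\<lambda>y. \<Sum>g\<in>G. m g y * ?D g y + ?D (m g) y * g y)"
    using m(1)
    by (intro smooth_combination_sum smooth_combination_add smooth_combination_mult smooth_on_dir_deriv U smooth_combination_base
        finite_prolongation G(1)) (auto simp: prolongation_def)
  ultimately show ?thesis
    by (subst smooth_combination_cong)
qed

lemma gronwall_zero: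
  fixes \<phi> :: "real \<Rightarrow> real"
  assumes der: "\<And>t. 0 \<le> t \<Longrightarrow> t \<le> 1 \<Longrightarrow> (\<phi> has_real_derivative \<phi>' t) (at t)"
    and le: "\<And>t. 0 \<le> t \<Longrightarrow> t \<le> 1 \<Longrightarrow> \<phi>' t \<le> K * \<phi> t"
    and "\<phi> 0 = 0" "\<phi> 1 \<ge> 0"
  shows "\<phi> 1 = 0"
proof -
  have "\<phi> 1 * exp (- K * 1) \<le> \<phi> 0 * exp (- K * 0)"
  proof (rule DERIV_nonpos_imp_nonincreasing[of 0 1 "\<lambda>t. \<phi> t * exp (- K * t)"])
    fix t :: real assume t: "0 \<le> t" "t \<le> 1"
    have "((\<lambda>t. \<phi> t * exp (- K * t)) has_real_derivative (\<phi>' t - K * \<phi> t) * exp (- K * t)) (at t)"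
      by (rule derivative_eq_intros der[OF t] refl)+ (simp add: algebra_simps)
    moreover have "(\<phi>' t - K * \<phi> t) * exp (- K * t) \<le> 0"
      using le[OF t] by (intro mult_nonpos_nonneg) auto
    ultimately show "\<exists>y. ((\<lambda>t. \<phi> t * exp (- K * t)) has_real_derivative y) (at t) \<and> y \<le> 0"
      by blast
  qed auto
  then show ?thesis
    using assms(3,4) by (simp add: mult_le_0_iff)
qed

lemma dir_deriv_axis_expansion:
  fixes f :: "real^'n::finite \<Rightarrow> real"
  assumes "f differentiable (at x)"
  shows "dir_deriv w f x = (\<Sum>k\<in>UNIV. w $ k * dir_deriv (axis k 1) f x)"
proof -
  have lin: "linear (\<lambda>v. dir_deriv v f x)"
    using has_derivative_linear[OF differentiable_has_dir_deriv[OF assms]] .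
  have "w = (\<Sum>k\<in>UNIV. (w $ k) *\<^sub>R axis k 1)"
    using basis_expansion[of w] by (simp add: scalar_mult_eq_scaleR)
  then have "dir_deriv w f x = dir_deriv (\<Sum>k\<in>UNIV. (w $ k) *\<^sub>R axis k 1) f x"
    by simp
  also have "\<dots> = (\<Sum>k\<in>UNIV. w $ k * dir_deriv (axis k 1) f x)"
    by (simp add: linear_sum[OF lin] linear_cmul[OF lin])
  finally show ?thesis .
qed

text \<open>
  Along the segment from \<open>y\<close> to \<open>z\<close> the generators solve a linear system of ordinary differential
  equations, whose coefficients are bounded because the segment is compact.  Gronwall's inequality for
  the sum of their squares then propagates the zero.
\<close>

lemma finite_type_unique_continuation:
  fixes G :: "(real^'n::finite \<Rightarrow> real) set"
  assumes U: "open U" and B: "convex B" "B \<subseteq> U"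
    and G: "finite G" "\<And>g. g \<in> G \<Longrightarrow> smooth_on U g"
    and closed: "\<And>g k. g \<in> G \<Longrightarrow> smooth_combination U G (dir_deriv (axis k 1) g)"
    and y: "y \<in> B" "\<And>g. g \<in> G \<Longrightarrow> g y = 0" and z: "z \<in> B" and g: "g \<in> G"
  shows "g z = 0"
proof -
  define w where "w = z - y"
  define \<gamma> where "\<gamma> t = y + t *\<^sub>R w" for t
  have \<gamma>U: "\<gamma> t \<in> U" if "0 \<le> t" "t \<le> 1" for t
  proof -
    have "\<gamma> t = (1 - t) *\<^sub>R y + t *\<^sub>R z"
      by (simp add: \<gamma>_def w_def algebra_simps)
    then show ?thesis
      using B y(1) z that by (simp add: convexD subset_iff)
  qed
  have "smooth_combination U G (dir_deriv w g)" if "g \<in> G" for g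
  proof -
    have "smooth_combination U G (\<lambda>x. \<Sum>k\<in>UNIV. w $ k * dir_deriv (axis k 1) g x)"
      by (intro smooth_combination_sum smooth_combination_cmult U closed that)
    moreover have "dir_deriv w g x = (\<Sum>k\<in>UNIV. w $ k * dir_deriv (axis k 1) g x)" if "x \<in> U" for x
      by (rule dir_deriv_axis_expansion[OF smooth_on_differentiable[OF G(2)[OF \<open>g \<in> G\<close>] that]])
    ultimately show ?thesis
      using smooth_combination_cong[of U "dir_deriv w g" "\<lambda>x. \<Sum>k\<in>UNIV. w $ k * dir_deriv (axis k 1) g x" G] by simp
  qed
  then have "\<forall>g\<in>G. \<exists>m. (\<forall>h\<in>G. smooth_on U (m h)) \<and> (\<forall>x\<in>U. dir_deriv w g x = (\<Sum>h\<in>G. m h x * h x))"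
    unfolding smooth_combination_def by blast
  from bchoice[OF this] obtain m where
    "\<forall>g\<in>G. (\<forall>h\<in>G. smooth_on U (m g h)) \<and> (\<forall>x\<in>U. dir_deriv w g x = (\<Sum>h\<in>G. m g h x * h x))" ..
  then have m: "\<And>g h. g \<in> G \<Longrightarrow> h \<in> G \<Longrightarrow> smooth_on U (m g h)"
    "\<And>g x. g \<in> G \<Longrightarrow> x \<in> U \<Longrightarrow> dir_deriv w g x = (\<Sum>h\<in>G. m g h x * h x)"
    by blast+
  have "\<exists>C. \<forall>t\<in>{0..1}. \<bar>m g h (\<gamma> t)\<bar> \<le> C" if "g \<in> G" "h \<in> G" for g h
  proof -
    have "continuous_on {0..1} (\<lambda>t. m g h (\<gamma> t))"
      using \<gamma>U by (intro continuous_on_compose2[OF smooth_on_continuous[OF m(1)[OF that]]])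
         (auto simp: \<gamma>_def intro!: continuous_intros)
    then have "bounded ((\<lambda>t. m g h (\<gamma> t)) ` {0..1})"
      by (intro compact_imp_bounded compact_continuous_image) auto
    then show ?thesis
      by (auto simp: bounded_iff)
  qed
  then obtain c where c: "\<And>g h t. g \<in> G \<Longrightarrow> h \<in> G \<Longrightarrow> t \<in> {0..1} \<Longrightarrow> \<bar>m g h (\<gamma> t)\<bar> \<le> c g h"
    by metis
  define C where "C = (\<Sum>g\<in>G. \<Sum>h\<in>G. \<bar>c g h\<bar>)"
  have C: "\<bar>m g h (\<gamma> t)\<bar> \<le> C" if "g \<in> G" "h \<in> G" "t \<in> {0..1}" for g h t
  proof -
    have "\<bar>m g h (\<gamma> t)\<bar> \<le> \<bar>c g h\<bar>"
      using c[OF that] by simp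
    also have "\<dots> \<le> (\<Sum>h\<in>G. \<bar>c g h\<bar>)"
      by (rule member_le_sum) (use that G in auto)
    also have "\<dots> \<le> C"
      unfolding C_def by (rule member_le_sum) (use that G in \<open>auto intro: sum_nonneg\<close>)
    finally show ?thesis .
  qed
  define \<phi> where "\<phi> t = (\<Sum>g\<in>G. (g (\<gamma> t))\<^sup>2)" for t
  define \<phi>' where "\<phi>' t = (\<Sum>g\<in>G. 2 * g (\<gamma> t) * dir_deriv w g (\<gamma> t))" for t
  have "\<phi> 1 = 0"
  proof (rule gronwall_zero)
    fix t :: real assume t: "0 \<le> t" "t \<le> 1"
    have "((\<lambda>t. g (\<gamma> t)) has_real_derivative dir_deriv w g (\<gamma> t)) (at t)" if "g \<in> G" for g
      using \<gamma>U[OF t] unfolding \<gamma>_def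
      by (intro has_real_derivative_along_line smooth_on_differentiable[OF G(2)[OF that]])
    then show "(\<phi> has_real_derivative \<phi>' t) (at t)"
      unfolding \<phi>_def[abs_def] \<phi>'_def
      by (intro DERIV_sum) (auto intro!: derivative_eq_intros)
    have "\<phi>' t = (\<Sum>g\<in>G. \<Sum>h\<in>G. 2 * m g h (\<gamma> t) * (g (\<gamma> t) * h (\<gamma> t)))"
      using \<gamma>U[OF t] by (simp add: \<phi>'_def m(2) sum_distrib_left mult_ac)
    also have "\<dots> \<le> (\<Sum>g\<in>G. \<Sum>h\<in>G. C * ((g (\<gamma> t))\<^sup>2 + (h (\<gamma> t))\<^sup>2))"
    proof (intro sum_mono)
      fix g h assume gh: "g \<in> G" "h \<in> G"
      let ?a = "g (\<gamma> t)" and ?b = "h (\<gamma> t)"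
      have "2 * m g h (\<gamma> t) * (?a * ?b) \<le> \<bar>m g h (\<gamma> t)\<bar> * \<bar>2 * ?a * ?b\<bar>"
        using abs_ge_self[of "m g h (\<gamma> t) * (2 * ?a * ?b)"] by (simp add: abs_mult mult_ac)
      also have "\<dots> \<le> C * (?a\<^sup>2 + ?b\<^sup>2)"
        using C[OF gh, of t] t sum_squares_bound[of ?a ?b] sum_squares_bound[of "-?a" ?b]
        by (intro mult_mono) (auto simp: abs_le_iff)
      finally show "2 * m g h (\<gamma> t) * (?a * ?b) \<le> C * (?a\<^sup>2 + ?b\<^sup>2)" .
    qed
    also have "\<dots> = (2 * C * card G) * \<phi> t"
      by (simp add: \<phi>_def distrib_left sum.distrib sum_distrib_left[symmetric] mult_ac)
    finally show "\<phi>' t \<le> (2 * C * card G) * \<phi> t" .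
  next
    show "\<phi> 0 = 0" by (simp add: \<phi>_def \<gamma>_def y)
    show "\<phi> 1 \<ge> 0" by (simp add: \<phi>_def sum_nonneg)
  qed
  then have "\<forall>g\<in>G. (g (\<gamma> 1))\<^sup>2 = 0"
    unfolding \<phi>_def using G(1) by (subst (asm) sum_nonneg_eq_0_iff) auto
  then show ?thesis
    using g by (simp add: \<gamma>_def w_def)
qed

section \<open>The Killing equation is of finite type\<close>

text \<open>
  \<open>T a b c d e\<close> stands for \<open>\<partial>\<^sub>a \<partial>\<^sub>b \<partial>\<^sub>c \<alpha>\<^sub>d\<^sub>e\<close>, and \<open>E a b c d e\<close> for \<open>\<partial>\<^sub>a \<partial>\<^sub>b\<close> of the cyclic sum with indices
  \<open>c, d, e\<close>.  For five given index slots there are ten unknowns \<open>T\<close>, labelled by the pair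
  \<open>{d, e}\<close>, and ten equations \<open>E\<close>, labelled by the pair \<open>{a, b}\<close>; equation \<open>p\<close> is the sum of the
  unknowns whose pair is disjoint from \<open>p\<close>.  The matrix of the system is thus the adjacency matrix
  \<open>P\<close> of the Petersen graph.  With \<open>J\<close> the all-ones matrix, \<open>P\<^sup>2 + P - 2 I = J\<close> and \<open>P J = 3 J\<close>,
  so \<open>P\<close> has the inverse \<open>(P + I) / 2 - J / 6\<close>.
\<close>

lemma third_derivatives_from_killing:
  fixes T E :: "'n \<Rightarrow> 'n \<Rightarrow> 'n \<Rightarrow> 'n \<Rightarrow> 'n \<Rightarrow> real"
  assumes T: "\<And>a b c d e. T a b c d e = T b a c d e" "\<And>a b c d e. T a b c d e = T a c b d e"
      "\<And>a b c d e. T a b c d e = T a b c e d"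
    and E: "\<And>a b c d e. E a b c d e = T a b c d e + T a b d c e + T a b e c d"
  shows "T a b c d e = (E d e a b c + E a b c d e + E a c b d e + E b c a d e) / 2
    - (E a b c d e + E a c b d e + E a d b c e + E a e b c d + E b c a d e + E b d a c e
       + E b e a c d + E c d a b e + E c e a b d + E d e a b c) / 6"
proof -
  show ?thesis
    unfolding E by (simp add: T field_simps)
qed

text \<open>
  Derivatives of the first two orders are generators already, so the point is the third order: there
  the elimination of \<open>third_derivatives_from_killing\<close> applies to the twice differentiated
  equations.
\<close>

lemma killing_system_closed:
  fixes h :: "'n::finite \<Rightarrow> 'n \<Rightarrow> real^'n \<Rightarrow> real"
  assumes U: "open U" and h: "\<And>i j. smooth_on U (h i j)" and sym: "\<And>i j. h i j = h j i"
    and G: "G = range (\<lambda>(i, j). h i j)"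
    and killing: "\<And>i j k. smooth_combination U G (\<lambda>y. dir_deriv (axis i 1) (h j k) y + dir_deriv (axis j 1) (h i k) y
        + dir_deriv (axis k 1) (h i j) y)"
    and g: "g \<in> prolongation (prolongation G)"
  shows "smooth_combination U (prolongation (prolongation G)) (dir_deriv (axis l 1) g)"
proof -
  have fin: "finite G" by (simp add: G)
  have smG: "\<And>g. g \<in> G \<Longrightarrow> smooth_on U g" using h by (auto simp: G)
  have smG1: "smooth_on U g" if "g \<in> prolongation G" for g
    using smooth_on_prolongation[OF smG that] .
  let ?G2 = "prolongation (prolongation G)"
  let ?D = "\<lambda>i. dir_deriv (axis i 1 :: real^'n)"
  define T where "T y a b c d e = ?D a (?D b (?D c (h d e))) y" for y a b c d e
  define K where "K c d e = (\<lambda>y. ?D c (h d e) y + ?D d (h c e) y + ?D e (h c d) y)" for c d e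
  have diff: "f differentiable at y" if "smooth_on U f" "y \<in> U" for f :: "real^'n \<Rightarrow> real" and y
    by (rule smooth_on_differentiable[OF that])
  have DK: "?D b (K c d e) y = ?D b (?D c (h d e)) y + ?D b (?D d (h c e)) y + ?D b (?D e (h c d)) y"
    if "y \<in> U" for b c d e y
    unfolding K_def using that U h
    by (simp add: dir_deriv_add diff smooth_on_dir_deriv smooth_on_add)
  have E: "?D a (?D b (K c d e)) y = T y a b c d e + T y a b d c e + T y a b e c d"
    if y: "y \<in> U" for y a b c d e
  proof -
    have "?D a (?D b (K c d e)) y =
       ?D a (\<lambda>y. ?D b (?D c (h d e)) y + ?D b (?D d (h c e)) y + ?D b (?D e (h c d)) y) y"
      by (rule dir_deriv_cong[OF U y DK])
    also have "\<dots> = T y a b c d e + T y a b d c e + T y a b e c d"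
      unfolding T_def using y U h by (simp add: dir_deriv_add diff smooth_on_dir_deriv smooth_on_add)
    finally show ?thesis .
  qed
  have T: "T y a b c d e = T y b a c d e" "T y a b c d e = T y a c b d e" "T y a b c d e = T y a b c e d"
    if y: "y \<in> U" for y a b c d e
  proof -
    show "T y a b c d e = T y b a c d e"
      unfolding T_def by (rule second_dir_deriv_commute[OF U smooth_on_dir_deriv[OF h] y])
    show "T y a b c d e = T y a c b d e"
      unfolding T_def by (rule dir_deriv_cong[OF U y second_dir_deriv_commute[OF U h]])
    show "T y a b c d e = T y a b c e d"
      unfolding T_def by (simp add: sym[of d e])
  qed
  have combE: "smooth_combination U ?G2 (\<lambda>y. ?D a (?D b (K c d e)) y)" for a b c d e
    using killing[of c d e] unfolding K_def
    by (intro smooth_combination_dir_deriv U finite_prolongation fin) (use smG smG1 in auto)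
  have combT: "smooth_combination U ?G2 (\<lambda>y. T y a b c d e)" for a b c d e
  proof -
    let ?E = "\<lambda>a b c d e y. ?D a (?D b (K c d e)) y"
    have eq: "T y a b c d e = (1/2) * (?E d e a b c y + ?E a b c d e y + ?E a c b d e y + ?E b c a d e y)
      - (1/6) * (?E a b c d e y + ?E a c b d e y + ?E a d b c e y + ?E a e b c d y + ?E b c a d e y
        + ?E b d a c e y + ?E b e a c d y + ?E c d a b e y + ?E c e a b d y + ?E d e a b c y)"
      if "y \<in> U" for y
      using third_derivatives_from_killing[of "T y" "\<lambda>a b c d e. ?E a b c d e y", OF T[OF that] E[OF that],
          of a b c d e] by simp
    show ?thesis
      by (subst smooth_combination_cong[OF eq], assumption)
         (intro smooth_combination_diff smooth_combination_cmult smooth_combination_add combE U)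
  qed
  have fin2: "finite ?G2" by (intro finite_prolongation fin)
  consider "g \<in> prolongation G" | b a d e where "g = ?D b (?D a (h d e))"
  proof (cases "g \<in> prolongation G")
    case False
    then obtain b g' where g': "g = ?D b g'" "g' \<in> prolongation G"
      using g by (auto simp: prolongation_def[of "prolongation G"])
    show thesis
    proof (cases "g' \<in> G")
      case True
      then have "g \<in> prolongation G" using g' by (auto simp: prolongation_def)
      then show thesis by (rule that(1))
    next
      case False
      then obtain a d e where "g' = ?D a (h d e)"
        using g' by (auto simp: prolongation_def G)
      then show thesis using that(2) g' by blast
    qed
  qed (rule that(1))
  then show ?thesis
  proof cases
    case 1
    then have "?D l g \<in> ?G2" by (auto simp: prolongation_def[of "prolongation G"])
    then show ?thesis by (rule smooth_combination_base[OF fin2])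
  next
    case 2
    then show ?thesis using combT[of l b a d e] by (simp add: T_def[abs_def])
  qed
qed

lemma killing_system_unique_continuation:
  fixes h :: "'n::finite \<Rightarrow> 'n \<Rightarrow> real^'n \<Rightarrow> real"
  assumes U: "open U" and B: "convex B" "B \<subseteq> U"
    and h: "\<And>i j. smooth_on U (h i j)" and sym: "\<And>i j. h i j = h j i"
    and killing: "\<And>i j k. smooth_combination U (range (\<lambda>(i, j). h i j))
        (\<lambda>y. dir_deriv (axis i 1) (h j k) y + dir_deriv (axis j 1) (h i k) y + dir_deriv (axis k 1) (h i j) y)"
    and y: "y \<in> B" "\<And>i j. h i j y = 0" "\<And>i j k. dir_deriv (axis k 1) (h i j) y = 0"
      "\<And>i j k l. dir_deriv (axis l 1) (dir_deriv (axis k 1) (h i j)) y = 0"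
    and z: "z \<in> B"
  shows "h i j z = 0"
proof -
  define G where "G = range (\<lambda>(i, j). h i j)"
  have smG: "\<And>g. g \<in> G \<Longrightarrow> smooth_on U g" using h by (auto simp: G_def)
  show ?thesis
  proof (rule finite_type_unique_continuation[OF U B, of "prolongation (prolongation G)" y z "h i j"])
    show "finite (prolongation (prolongation G))"
      by (intro finite_prolongation) (simp add: G_def)
    show "smooth_on U g" if "g \<in> prolongation (prolongation G)" for g
      using that by (intro smooth_on_prolongation[OF smooth_on_prolongation[OF smG]])
    show "smooth_combination U (prolongation (prolongation G)) (dir_deriv (axis k 1) g)"
      if "g \<in> prolongation (prolongation G)" for g k
      using killing by (intro killing_system_closed[OF U h sym G_def _ that]) (simp add: G_def)
    show "g y = 0" if "g \<in> prolongation (prolongation G)" for g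
      using that y by (auto simp: prolongation_def G_def)
    show "h i j \<in> prolongation (prolongation G)"
      by (auto simp: prolongation_def G_def)
  qed (use y z in auto)
qed

section \<open>Killing tensors on a manifold\<close>

lemma pd_eq_dir_deriv: "pd c k F x = dir_deriv (axis k 1) (F \<circ> param c) (coord c x)"
  by (simp add: pd_def dir_deriv_def)

lemma
  assumes "smooth_manifold M A" "c \<in> A"
  shows chart_open: "open (coord c ` cdom c)"
    and param_coord: "\<And>x. x \<in> cdom c \<Longrightarrow> param c (coord c x) = x"
    and param_in_cdom: "\<And>y. y \<in> coord c ` cdom c \<Longrightarrow> param c y \<in> cdom c"
    and coord_param: "\<And>y. y \<in> coord c ` cdom c \<Longrightarrow> coord c (param c y) = y"
    and chart_preimage_open: "\<And>B. open B \<Longrightarrow> openin M {x \<in> cdom c. coord c x \<in> B}"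
proof -
  have ch: "is_chart M c"
    using assms by (simp add: smooth_manifold_def)
  then show "open (coord c ` cdom c)"
    by (simp add: is_chart_def)
  have op: "openin M (cdom c)"
    using ch by (simp add: is_chart_def)
  have hom: "homeomorphic_map (subtopology M (cdom c)) (top_of_set (coord c ` cdom c)) (coord c)"
    using ch by (simp add: is_chart_def)
  have top: "topspace (subtopology M (cdom c)) = cdom c"
    using openin_subset[OF op] by auto
  have inj: "inj_on (coord c) (cdom c)"
    using homeomorphic_imp_injective_map[OF hom] by (simp only: top)
  show "param c (coord c x) = x" if "x \<in> cdom c" for x
    using inj that by (simp add: param_def)
  then show "param c y \<in> cdom c" "coord c (param c y) = y" if "y \<in> coord c ` cdom c" for y
    using that by auto
  show "openin M {x \<in> cdom c. coord c x \<in> B}" if "open B" for B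
  proof -
    have "continuous_map (subtopology M (cdom c)) (top_of_set (coord c ` cdom c)) (coord c)"
      by (rule homeomorphic_imp_continuous_map[OF hom])
    then have "continuous_map (subtopology M (cdom c)) euclidean (coord c)"
      by (simp add: continuous_map_in_subtopology)
    then have "openin (subtopology M (cdom c)) {x \<in> cdom c. coord c x \<in> B}"
      using openin_continuous_map_preimage[of "subtopology M (cdom c)" euclidean "coord c" B] that
      unfolding top by simp
    then show ?thesis
      using op by (simp add: openin_open_subtopology)
  qed
qed

definition component :: "('a, 'n::finite) tensor \<Rightarrow> ('a, 'n) chart \<Rightarrow> 'n \<Rightarrow> 'n \<Rightarrow> real^'n \<Rightarrow> real" where
  "component \<alpha> c i j = (\<lambda>y. \<alpha> c (param c y) [i, j])"

lemma component_coord: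
  assumes "smooth_manifold M A" "c \<in> A" "x \<in> cdom c"
  shows "component \<alpha> c i j (coord c x) = \<alpha> c x [i, j]"
  by (simp add: component_def param_coord[OF assms])

lemma smooth_on_component:
  "\<alpha> \<in> sym_tensors A p \<Longrightarrow> c \<in> A \<Longrightarrow> smooth_on (coord c ` cdom c) (component \<alpha> c i j)"
  unfolding sym_tensors_def covariant_tensor_def component_def by blast

lemma sym_tensors_swap: "\<alpha> \<in> sym_tensors A p \<Longrightarrow> \<alpha> c x [i, j] = \<alpha> c x [j, i]"
  unfolding sym_tensors_def mem_Collect_eq by (metis add_mset_commute mset.simps(2))

lemma component_swap: "\<alpha> \<in> sym_tensors A p \<Longrightarrow> component \<alpha> c i j = component \<alpha> c j i"
  unfolding component_def using sym_tensors_swap by fastforce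

lemma pd_component: "pd c k (\<lambda>z. \<alpha> c z [i, j]) x = dir_deriv (axis k 1) (component \<alpha> c i j) (coord c x)"
  by (simp add: pd_eq_dir_deriv component_def comp_def)

lemma nabla_coord_pair:
  "nabla_coord g c k \<alpha> x [i, j] = dir_deriv (axis k 1) (component \<alpha> c i j) (coord c x)
     - (\<Sum>l\<in>UNIV. christoffel g c x l k i * \<alpha> c x [l, j])
     - (\<Sum>l\<in>UNIV. christoffel g c x l k j * \<alpha> c x [i, l])"
  by (simp add: nabla_coord_def pd_component lessThan_Suc algebra_simps)

lemma smooth_on_christoffel:
  fixes g :: "('a, 'n::finite) tensor"
  assumes M: "smooth_manifold M A" and g: "riemannian_metric A g" and c: "c \<in> A"
  shows "smooth_on (coord c ` cdom c) (\<lambda>y. christoffel g c (param c y) l k i)"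
proof -
  let ?U = "coord c ` cdom c"
  note U = chart_open[OF M c]
  have gs: "g \<in> sym_tensors A 2"
    using g by (simp add: riemannian_metric_def)
  have inv: "smooth_on ?U (\<lambda>y. inverse_metric g c (param c y) $ l $ m)" for l m
    unfolding inverse_metric_def
    using smooth_on_component[OF gs c, unfolded component_def] metric_matrix_invertible[OF g c]
    by (intro smooth_on_matrix_inv U) (auto simp: param_in_cdom[OF M c] param_coord[OF M c])
  have pd: "smooth_on ?U (\<lambda>y. pd c k (\<lambda>z. g c z [i, j]) (param c y))" for k i j
    using smooth_on_dir_deriv[OF smooth_on_component[OF gs c, of i j], of "axis k 1"]
    by (subst smooth_on_cong[OF U]) (auto simp: pd_component param_coord[OF M c])
  show ?thesis
    unfolding christoffel_def
    by (intro smooth_on_divide smooth_on_sum smooth_on_mult smooth_on_add smooth_on_diff inv pd U smooth_on_const)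
       simp
qed

text \<open>
  The value of \<open>d\<^sup>s \<alpha>\<close> on coordinate vectors, freed from the orthonormal frame.
\<close>

definition killing_cyclic :: "('a, 'n::finite) tensor \<Rightarrow> ('a, 'n) chart \<Rightarrow> ('a, 'n) tensor \<Rightarrow> 'a \<Rightarrow> 'n \<Rightarrow> 'n \<Rightarrow> 'n \<Rightarrow> real" where
  "killing_cyclic g c \<alpha> x i j k =
     nabla_coord g c i \<alpha> x [j, k] + nabla_coord g c j \<alpha> x [i, k] + nabla_coord g c k \<alpha> x [i, j]"

definition killing_2_tensors :: "('a, 'n::finite) chart set \<Rightarrow> ('a, 'n) tensor \<Rightarrow> ('a, 'n) tensor set" where
  "killing_2_tensors A g = {\<alpha> \<in> sym_tensors A 2. \<forall>c\<in>A. \<forall>x\<in>cdom c. \<forall>i j k. killing_cyclic g c \<alpha> x i j k = 0}"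

lemma sum_apply_fun: "(\<Sum>a\<in>I. F a) x = (\<Sum>a\<in>I. F a x)"
  for F :: "'i \<Rightarrow> 'b \<Rightarrow> real"
  by (induction I rule: infinite_finite_induct) auto

text \<open>
  A left inverse of a square matrix is also a right inverse: duality of frame and coframe turns into
  the expansion of a coordinate vector in the frame.
\<close>

lemma frame_expansion:
  fixes g :: "('a, 'n::finite) tensor"
  assumes g: "riemannian_metric A g" and cx: "c \<in> A" "x \<in> cdom c" and e: "orthonormal_frame g c x e"
  shows "(\<Sum>a\<in>UNIV. dual_coframe e a $ i * e a $ m) = (if i = m then 1 else 0)"
proof -
  define P where "P = ((\<chi> a i. dual_coframe e a $ i) :: real^'n^'n)"
  define Q where "Q = ((\<chi> i a. e a $ i) :: real^'n^'n)"
  have "P ** Q = mat 1"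
    using e by (simp add: P_def Q_def matrix_matrix_mult_def mat_def vec_eq_iff orthonormal_frame_def
        dual_coframe_orthonormal[OF g cx e, unfolded inner_vec_def, simplified])
  then have "Q ** P = mat 1"
    by (simp add: matrix_left_right_inverse)
  then have "(Q ** P) $ m $ i = mat 1 $ m $ i" by simp
  then show ?thesis
    by (simp add: P_def Q_def matrix_matrix_mult_def mat_def mult.commute)
qed

lemma sym_derivative_eq_killing_cyclic:
  fixes g :: "('a, 'n::finite) tensor"
  assumes g: "riemannian_metric A g" and cx: "c \<in> A" "x \<in> cdom c"
  shows "sym_derivative A g 2 \<alpha> c x [i, j, k] = killing_cyclic g c \<alpha> x i j k"
proof -
  define e where "e = (SOME e. orthonormal_frame g c x e)"
  have e: "orthonormal_frame g c x e"
    unfolding e_def using orthonormal_frame_exists[OF g cx] by (rule someI_ex)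
  have contract: "(\<Sum>a\<in>UNIV. dual_coframe e a $ i * nabla g c (e a) \<alpha> x is) = nabla_coord g c i \<alpha> x is" for i "is"
  proof -
    have "(\<Sum>a\<in>UNIV. dual_coframe e a $ i * nabla g c (e a) \<alpha> x is)
      = (\<Sum>m\<in>UNIV. (\<Sum>a\<in>UNIV. dual_coframe e a $ i * e a $ m) * nabla_coord g c m \<alpha> x is)"
      unfolding nabla_def sum_distrib_left sum_distrib_right
      by (subst sum.swap) (simp add: mult_ac)
    also have "\<dots> = nabla_coord g c i \<alpha> x is"
      by (simp add: frame_expansion[OF g cx e] if_distrib[of "\<lambda>t. t * _"] cong: if_cong)
    finally show ?thesis .
  qed
  have "sym_derivative A g 2 \<alpha> c x [i, j, k]
     = (\<Sum>a\<in>UNIV. sym_mult (dual_coframe e a) (nabla g c (e a) \<alpha> x) [i, j, k])"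
    using cx by (simp add: sym_derivative_def e_def Let_def sum_apply_fun)
  also have "\<dots> = killing_cyclic g c \<alpha> x i j k"
    by (simp add: sym_mult_def lessThan_Suc sum.distrib contract killing_cyclic_def numeral_2_eq_2)
  finally show ?thesis .
qed

lemma div_free_killing_subset: "riemannian_metric A g \<Longrightarrow> div_free_killing A g 2 \<subseteq> killing_2_tensors A g"
  unfolding div_free_killing_def killing_2_tensors_def
  by (auto simp: sym_derivative_eq_killing_cyclic[symmetric] zero_fun_def)

lemma killing_component_equation:
  fixes g :: "('a, 'n::finite) tensor"
  assumes M: "smooth_manifold M A" and c: "c \<in> A"
    and \<alpha>: "\<alpha> \<in> killing_2_tensors A g" and x: "x \<in> cdom c"
  shows "dir_deriv (axis i 1) (component \<alpha> c j k) (coord c x) + dir_deriv (axis j 1) (component \<alpha> c i k) (coord c x)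
      + dir_deriv (axis k 1) (component \<alpha> c i j) (coord c x)
    = (\<Sum>l\<in>UNIV. (christoffel g c x l i j + christoffel g c x l j i) * \<alpha> c x [l, k]
       + (christoffel g c x l i k + christoffel g c x l k i) * \<alpha> c x [l, j]
       + (christoffel g c x l j k + christoffel g c x l k j) * \<alpha> c x [l, i])"
proof -
  have s: "\<alpha> c x [a, b] = \<alpha> c x [b, a]" for a b
    by (rule sym_tensors_swap[of _ A 2]) (use \<alpha> in \<open>simp add: killing_2_tensors_def\<close>)
  have "killing_cyclic g c \<alpha> x i j k = 0"
    using \<alpha> c x by (simp add: killing_2_tensors_def)
  then show ?thesis
    unfolding killing_cyclic_def nabla_coord_pair
    by (simp add: s[of i] s[of j] s[of k] sum.distrib algebra_simps)
qed

lemma killing_equation_smooth_combination: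
  fixes g :: "('a, 'n::finite) tensor"
  assumes M: "smooth_manifold M A" and g: "riemannian_metric A g" and c: "c \<in> A"
    and \<alpha>: "\<alpha> \<in> killing_2_tensors A g"
  shows "smooth_combination (coord c ` cdom c) (range (\<lambda>(i, j). component \<alpha> c i j))
     (\<lambda>y. dir_deriv (axis i 1) (component \<alpha> c j k) y + dir_deriv (axis j 1) (component \<alpha> c i k) y
        + dir_deriv (axis k 1) (component \<alpha> c i j) y)" (is "smooth_combination ?U ?G ?K")
proof -
  note U = chart_open[OF M c]
  let ?\<Gamma> = "\<lambda>l i j y. christoffel g c (param c y) l i j + christoffel g c (param c y) l j i"
  have eq: "?K y = (\<Sum>l\<in>UNIV. ?\<Gamma> l i j y * component \<alpha> c l k y + ?\<Gamma> l i k y * component \<alpha> c l j y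
       + ?\<Gamma> l j k y * component \<alpha> c l i y)" if "y \<in> ?U" for y
    using killing_component_equation[OF M c \<alpha> param_in_cdom[OF M c that], of i j k]
    by (simp add: coord_param[OF M c that] component_def)
  have \<Gamma>: "smooth_on ?U (?\<Gamma> l i j)" for l i j
    by (intro smooth_on_add smooth_on_christoffel[OF M g c] U)
  have base: "smooth_combination ?U ?G (component \<alpha> c i j)" for i j
    by (rule smooth_combination_base) auto
  show ?thesis
    by (subst smooth_combination_cong[OF eq], assumption)
       (intro smooth_combination_sum smooth_combination_add smooth_combination_mult \<Gamma> base U)
qed

lemma killing_unique_continuation_in_chart:
  fixes g :: "('a, 'n::finite) tensor"
  assumes M: "smooth_manifold M A" and g: "riemannian_metric A g" and c: "c \<in> A"
    and \<alpha>: "\<alpha> \<in> killing_2_tensors A g" and B: "convex B" "B \<subseteq> coord c ` cdom c"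
    and y: "y \<in> B" "\<And>i j. component \<alpha> c i j y = 0" "\<And>i j k. dir_deriv (axis k 1) (component \<alpha> c i j) y = 0"
      "\<And>i j k l. dir_deriv (axis l 1) (dir_deriv (axis k 1) (component \<alpha> c i j)) y = 0"
    and z: "z \<in> B"
  shows "component \<alpha> c i j z = 0"
proof -
  have s: "\<alpha> \<in> sym_tensors A 2" using \<alpha> by (simp add: killing_2_tensors_def)
  show ?thesis
    by (rule killing_system_unique_continuation[OF chart_open[OF M c] B smooth_on_component[OF s c]
        component_swap[OF s] killing_equation_smooth_combination[OF M g c \<alpha>] y z])
qed

lemma sym_tensors_zero_any_chart:
  fixes \<alpha> :: "('a, 'n::finite) tensor"
  assumes \<alpha>: "\<alpha> \<in> sym_tensors A 2" and c: "c \<in> A" "x \<in> cdom c" "\<And>i j. \<alpha> c x [i, j] = 0"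
  shows "\<alpha> d x js = 0"
proof (cases "d \<in> A \<and> x \<in> cdom d \<and> length js = 2")
  case True
  have "\<alpha> c x is = 0" if "length is = 2" for "is"
    using that c(3) by (auto simp: length_Suc_conv numeral_2_eq_2)
  moreover have "\<alpha> d x js = (\<Sum>is | length is = 2. (\<Prod>k<2. jacobian d c x (is ! k) (js ! k)) * \<alpha> c x is)"
    using \<alpha> c True unfolding sym_tensors_def covariant_tensor_def by blast
  ultimately show ?thesis by simp
next
  case False
  then show ?thesis
    using \<alpha> unfolding sym_tensors_def covariant_tensor_def by blast
qed

text \<open>
  Let \<open>Z\<close> be the set of points with a neighbourhood on which \<open>\<alpha>\<close> vanishes.  A ball in a chart that
  meets \<open>Z\<close> contains a point where all derivatives vanish, so \<open>\<alpha>\<close> vanishes on the whole ball;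
  hence \<open>Z\<close> is closed.  It is open by definition and contains \<open>x\<close> by the assumption on the jet.
\<close>

lemma killing_eq_0_if_jet_eq_0:
  fixes g :: "('a, 'n::finite) tensor"
  assumes M: "smooth_manifold M A" and conn: "connected_space M"
    and g: "riemannian_metric A g" and c: "c \<in> A" "x \<in> cdom c"
    and \<alpha>: "\<alpha> \<in> killing_2_tensors A g"
    and jet: "\<And>i j. component \<alpha> c i j (coord c x) = 0" "\<And>i j k. dir_deriv (axis k 1) (component \<alpha> c i j) (coord c x) = 0"
      "\<And>i j k l. dir_deriv (axis l 1) (dir_deriv (axis k 1) (component \<alpha> c i j)) (coord c x) = 0"
  shows "\<alpha> = 0"
proof -
  have s: "\<alpha> \<in> sym_tensors A 2" using \<alpha> by (simp add: killing_2_tensors_def)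
  define Z where "Z = {x \<in> topspace M. \<exists>W. openin M W \<and> x \<in> W \<and> (\<forall>z\<in>W. \<forall>d js. \<alpha> d z js = 0)}"
  have nbhd: "\<exists>W. openin M W \<and> x \<in> W \<and> (\<exists>r>0. W = {z \<in> cdom c. coord c z \<in> ball (coord c x) r}
      \<and> ball (coord c x) r \<subseteq> coord c ` cdom c)" if cx: "c \<in> A" "x \<in> cdom c" for c x
  proof -
    obtain r where "r > 0" "ball (coord c x) r \<subseteq> coord c ` cdom c"
      using chart_open[OF M cx(1)] cx(2) openE by (metis imageI)
    then show ?thesis
      using chart_preimage_open[OF M cx(1) open_ball[of "coord c x" r]] cx(2) by auto
  qed
  have vanish: "\<alpha> d z js = 0"
    if "c \<in> A" and B: "convex B" "B \<subseteq> coord c ` cdom c" and y: "y \<in> B" "\<And>i j. component \<alpha> c i j y = 0"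
      "\<And>i j k. dir_deriv (axis k 1) (component \<alpha> c i j) y = 0"
      "\<And>i j k l. dir_deriv (axis l 1) (dir_deriv (axis k 1) (component \<alpha> c i j)) y = 0"
      and z: "z \<in> cdom c" "coord c z \<in> B" for c B y z d js
  proof (rule sym_tensors_zero_any_chart[OF s \<open>c \<in> A\<close> z(1)])
    show "\<alpha> c z [i, j] = 0" for i j
      using killing_unique_continuation_in_chart[OF M g \<open>c \<in> A\<close> \<alpha> B y z(2), of i j]
        component_coord[OF M \<open>c \<in> A\<close> z(1), of \<alpha> i j] by simp
  qed
  have "openin M Z"
  proof (subst openin_subopen, intro ballI)
    fix x assume "x \<in> Z"
    then obtain W where W: "openin M W" "x \<in> W" "\<forall>z\<in>W. \<forall>d js. \<alpha> d z js = 0"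
      unfolding Z_def by blast
    then have "W \<subseteq> Z"
      unfolding Z_def using openin_subset[OF W(1)] by blast
    then show "\<exists>T. openin M T \<and> x \<in> T \<and> T \<subseteq> Z" using W by blast
  qed
  moreover have "closedin M Z"
    unfolding closedin_def
  proof (intro conjI)
    show "Z \<subseteq> topspace M" by (auto simp: Z_def)
    show "openin M (topspace M - Z)"
    proof (subst openin_subopen, intro ballI)
      fix x assume x: "x \<in> topspace M - Z"
      moreover have "topspace M = (\<Union>c\<in>A. cdom c)"
        using M by (simp add: smooth_manifold_def)
      ultimately obtain c where c: "c \<in> A" "x \<in> cdom c"
        by blast
      let ?U = "coord c ` cdom c"
      obtain W r where W: "openin M W" "x \<in> W" "W = {z \<in> cdom c. coord c z \<in> ball (coord c x) r}"
        "ball (coord c x) r \<subseteq> ?U"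
        using nbhd[OF c] by blast
      have "W \<inter> Z = {}"
      proof (rule ccontr)
        assume "W \<inter> Z \<noteq> {}"
        then obtain p V where p: "p \<in> W" "openin M V" "p \<in> V" "\<forall>z\<in>V. \<forall>d js. \<alpha> d z js = 0"
          unfolding Z_def by blast
        \<comment> \<open>The components vanish on the neighbourhood \<open>N\<close> of \<open>coord c p\<close>, hence so do their derivatives there.\<close>
        define N where "N = coord c ` (V \<inter> cdom c)"
        have "open N"
        proof -
          have hom: "homeomorphic_map (subtopology M (cdom c)) (top_of_set ?U) (coord c)"
            using M c by (simp add: smooth_manifold_def is_chart_def)
          have "openin (subtopology M (cdom c)) (V \<inter> cdom c)"
            using p(2) by (auto simp: openin_subtopology)
          then have "openin (top_of_set ?U) N"
            unfolding N_def using homeomorphic_imp_open_map[OF hom] by (simp add: open_map_def)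
          then show ?thesis
            using openin_open_trans chart_open[OF M c(1)] by blast
        qed
        have pc: "p \<in> cdom c" using p(1) W(3) by simp
        have pN: "coord c p \<in> N" using p(3) pc by (auto simp: N_def)
        have h0: "component \<alpha> c i j y = 0" if yN: "y \<in> N" for i j y
        proof -
          obtain q where q: "q \<in> V" "q \<in> cdom c" "y = coord c q"
            using yN by (auto simp: N_def)
          then have "\<alpha> c q [i, j] = 0" using p(4) by blast
          then show ?thesis by (simp add: q(3) component_coord[OF M c(1) q(2)])
        qed
        have h1: "dir_deriv v (component \<alpha> c i j) y = 0" if "y \<in> N" for i j y v
          using dir_deriv_cong[OF \<open>open N\<close> that, of "component \<alpha> c i j" "\<lambda>_. 0" v] h0 by (simp add: dir_deriv_const)
        have h2: "dir_deriv w (dir_deriv v (component \<alpha> c i j)) y = 0" if "y \<in> N" for i j y v w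
          using dir_deriv_cong[OF \<open>open N\<close> that, of "dir_deriv v (component \<alpha> c i j)" "\<lambda>_. 0" w] h1
          by (simp add: dir_deriv_const)
        have "\<alpha> d z js = 0" if "z \<in> W" for z d js
          using that p(1) W(3)
          by (intro vanish[OF c(1) convex_ball W(4) _ h0[OF pN] h1[OF pN] h2[OF pN]]) simp_all
        then have "x \<in> Z"
          unfolding Z_def using W(1,2) x by blast
        then show False using x by simp
      qed
      then show "\<exists>T. openin M T \<and> x \<in> T \<and> T \<subseteq> topspace M - Z"
        using W openin_subset[OF W(1)] by blast
    qed
  qed
  moreover have "x \<in> Z"
  proof -
    obtain W r where W: "openin M W" "x \<in> W" "W = {z \<in> cdom c. coord c z \<in> ball (coord c x) r}"
      "ball (coord c x) r \<subseteq> coord c ` cdom c"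
      using nbhd[OF c] by blast
    have "coord c x \<in> ball (coord c x) r"
      using W by simp
    then have "\<alpha> d z js = 0" if "z \<in> W" for z d js
      using that W(3) by (intro vanish[OF c(1) convex_ball W(4) _ jet]) simp_all
    moreover have "x \<in> topspace M"
      using W openin_subset[OF W(1)] by blast
    ultimately show ?thesis
      unfolding Z_def using W(1,2) by blast
  qed
  ultimately have "Z = topspace M"
    using conn unfolding connected_space_clopen_in by blast
  have "\<alpha> d z js = 0" for d z js
  proof (cases "z \<in> topspace M")
    case True
    then have "z \<in> Z" using \<open>Z = topspace M\<close> by simp
    then show ?thesis unfolding Z_def by blast
  next
    case False
    moreover have "topspace M = (\<Union>c\<in>A. cdom c)"
      using M by (simp add: smooth_manifold_def)
    ultimately have "\<not> (d \<in> A \<and> z \<in> cdom d)"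
      by blast
    then show ?thesis
      using s unfolding sym_tensors_def covariant_tensor_def by blast
  qed
  then show ?thesis by (simp add: fun_eq_iff)
qed

section \<open>Dimension of the space of admissible jets\<close>

text \<open>
  Spaces of tensors with prescribed index symmetries: \<open>\<kappa>\<close> sends an index tuple to its orbit, so that
  the dimension is the number of orbits.
\<close>

definition fibre_constant :: "('i::finite \<Rightarrow> 'k) \<Rightarrow> (real^'i) set" where
  "fibre_constant \<kappa> = {v. \<forall>i j. \<kappa> i = \<kappa> j \<longrightarrow> v $ i = v $ j}"

lemma fibre_constantD: "v \<in> fibre_constant \<kappa> \<Longrightarrow> \<kappa> i = \<kappa> j \<Longrightarrow> v $ i = v $ j"
  unfolding fibre_constant_def by blast

lemma subspace_fibre_constant: "subspace (fibre_constant \<kappa>)"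
proof (rule subspaceI)
  show "0 \<in> fibre_constant \<kappa>"
    by (simp add: fibre_constant_def)
next
  fix x y and c :: real assume x: "x \<in> fibre_constant \<kappa>"
  show "x + y \<in> fibre_constant \<kappa>" if y: "y \<in> fibre_constant \<kappa>"
    unfolding fibre_constant_def
  proof (intro CollectI allI impI)
    fix i j assume ij: "\<kappa> i = \<kappa> j"
    show "(x + y) $ i = (x + y) $ j"
      by (simp add: fibre_constantD[OF x ij] fibre_constantD[OF y ij])
  qed
  show "c *\<^sub>R x \<in> fibre_constant \<kappa>"
    unfolding fibre_constant_def
  proof (intro CollectI allI impI)
    fix i j assume ij: "\<kappa> i = \<kappa> j"
    show "(c *\<^sub>R x) $ i = (c *\<^sub>R x) $ j"
      by (simp add: fibre_constantD[OF x ij])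
  qed
qed

lemma dim_fibre_constant:
  fixes \<kappa> :: "'i::finite \<Rightarrow> 'k"
  shows "dim (fibre_constant \<kappa>) = card (range \<kappa>)"
proof -
  define e :: "'k \<Rightarrow> real^'i" where "e K = (\<chi> i. if \<kappa> i = K then 1 else 0)" for K
  have inj: "inj_on e (range \<kappa>)"
  proof (rule inj_onI, elim imageE)
    fix K K' i i' assume "e K = e K'" and K: "K = \<kappa> i"
    then have "e K $ i = e K' $ i" by simp
    then show "K = K'" using K by (simp add: e_def split: if_splits)
  qed
  have "orthogonal (e K) (e K')" if "K \<noteq> K'" for K K'
    unfolding orthogonal_def inner_vec_def using that by (intro sum.neutral) (simp add: e_def)
  then have "pairwise orthogonal (e ` range \<kappa>)"
    unfolding pairwise_def by (metis image_iff)
  moreover have "0 \<notin> e ` range \<kappa>"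
  proof (rule notI, elim imageE)
    fix K i assume "0 = e K" "K = \<kappa> i"
    then have "e (\<kappa> i) $ i = 0" by (simp flip: \<open>0 = e K\<close>)
    then show False by (simp add: e_def)
  qed
  ultimately have ind: "independent (e ` range \<kappa>)"
    by (rule pairwise_orthogonal_independent)
  have sub: "e ` range \<kappa> \<subseteq> fibre_constant \<kappa>"
    by (auto simp: e_def fibre_constant_def)
  have "fibre_constant \<kappa> \<subseteq> span (e ` range \<kappa>)"
  proof
    fix v assume v: "v \<in> fibre_constant \<kappa>"
    have "v = (\<Sum>K\<in>range \<kappa>. (v $ (SOME i. \<kappa> i = K)) *\<^sub>R e K)"
    proof (rule vec_eq_iff[THEN iffD2], rule allI)
      fix i
      have "(\<Sum>K\<in>range \<kappa>. (v $ (SOME i. \<kappa> i = K)) *\<^sub>R e K) $ i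
          = (\<Sum>K\<in>range \<kappa>. if K = \<kappa> i then v $ (SOME i. \<kappa> i = K) else 0)"
        unfolding sum_component by (intro sum.cong) (auto simp: e_def)
      also have "\<dots> = v $ (SOME j. \<kappa> j = \<kappa> i)"
        by simp
      also have "\<dots> = v $ i"
        by (rule fibre_constantD[OF v]) (rule someI, rule refl)
      finally show "v $ i = (\<Sum>K\<in>range \<kappa>. (v $ (SOME i. \<kappa> i = K)) *\<^sub>R e K) $ i" ..
    qed
    also have "\<dots> \<in> span (e ` range \<kappa>)"
      by (intro span_sum span_scale span_base) auto
    finally show "v \<in> span (e ` range \<kappa>)" .
  qed
  then have "dim (fibre_constant \<kappa>) = card (e ` range \<kappa>)"
    using dim_unique[OF sub _ ind] by blast
  then show ?thesis
    by (simp add: card_image[OF inj])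
qed

text \<open>
  Linear constraints on \<open>W\<close> that are parametrised injectively by \<open>P\<close> cut down the dimension by
  \<open>dim P\<close>.  Injectivity of the transposed map \<open>L\<close> is easier to check than surjectivity of the
  constraint map itself.
\<close>

lemma dim_annihilator_le:
  fixes L :: "'a::euclidean_space \<Rightarrow> 'b::euclidean_space"
  assumes "linear L" "subspace P" "subspace B" "\<And>x. x \<in> P \<Longrightarrow> L x \<in> B"
    and inj: "\<And>x. x \<in> P \<Longrightarrow> L x = 0 \<Longrightarrow> x = 0"
    and W: "W \<subseteq> B" "\<And>w x. w \<in> W \<Longrightarrow> x \<in> P \<Longrightarrow> L x \<bullet> w = 0"
  shows "dim W + dim P \<le> dim B"
proof -
  have "inj_on L P"
  proof (rule inj_onI)
    fix x y assume "x \<in> P" "y \<in> P" "L x = L y"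
    then have "L (x - y) = 0" "x - y \<in> P"
      using assms(1,2) by (auto simp: linear_diff subspace_diff)
    then show "x = y" using inj by force
  qed
  then have "dim (L ` P) = dim P"
    using assms(1,2) by (intro dim_image_eq) (simp_all add: span_eq_iff[THEN iffD2])
  moreover have "dim W \<le> dim {y \<in> B. \<forall>x \<in> L ` P. orthogonal x y}"
    using W by (intro dim_subset) (auto simp: orthogonal_def)
  moreover have "dim {y \<in> B. \<forall>x \<in> L ` P. orthogonal x y} + dim (L ` P) = dim B"
    using assms by (intro dim_subspace_orthogonal_to_vectors linear_subspace_image) auto
  ultimately show ?thesis by linarith
qed

text \<open>
  The map need only be linear on a subspace \<open>K\<close>: the derivative of a function that is not
  differentiable is arbitrary, so taking jets is linear on smooth tensors only.
\<close>

lemma dim_le_via_injection: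
  fixes scale :: "real \<Rightarrow> 'b::ab_group_add \<Rightarrow> 'b" and J :: "'b \<Rightarrow> 'e::euclidean_space"
  assumes "vector_space scale" and K: "module.subspace scale K" and D: "D \<subseteq> K"
    and add: "\<And>x y. x \<in> K \<Longrightarrow> y \<in> K \<Longrightarrow> J (x + y) = J x + J y"
    and scale: "\<And>r x. x \<in> K \<Longrightarrow> J (scale r x) = r *\<^sub>R J x"
    and inj: "\<And>x. x \<in> K \<Longrightarrow> J x = 0 \<Longrightarrow> x = 0"
    and W: "J ` D \<subseteq> W"
  shows "(\<exists>B. finite B \<and> D \<subseteq> module.span scale B) \<and> vector_space.dim scale D \<le> dim W"
proof -
  interpret V: vector_space scale by fact
  obtain B where B: "B \<subseteq> D" "V.independent B" "D \<subseteq> V.span B" "card B = V.dim D"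
    using V.basis_exists .
  have BK: "B \<subseteq> K" using B(1) D by blast
  have le: "card F \<le> dim W" if F: "finite F" "F \<subseteq> B" for F
  proof -
    have FK: "\<And>x. x \<in> F \<Longrightarrow> x \<in> K" using F BK by blast
    have sum: "J (\<Sum>x\<in>G. scale (u x) x) = (\<Sum>x\<in>G. u x *\<^sub>R J x)" if "G \<subseteq> F" for u G
      using finite_subset[OF that F(1)] that
    proof (induction G rule: finite_induct)
      case empty
      have "J (scale 0 0) = 0 *\<^sub>R J 0"
        by (rule scale[OF V.subspace_0[OF K]])
      then show ?case by simp
    next
      case (insert x G)
      then have "J (scale (u x) x + (\<Sum>x\<in>G. scale (u x) x)) = J (scale (u x) x) + J (\<Sum>x\<in>G. scale (u x) x)"
        using FK by (intro add V.subspace_sum[OF K] V.subspace_scale[OF K]) auto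
      with insert show ?case
        using FK by (simp add: scale)
    qed
    have injF: "inj_on J F"
    proof (rule inj_onI)
      fix x y assume xy: "x \<in> F" "y \<in> F" "J x = J y"
      have "J (x + scale (-1) y) = J x + (-1) *\<^sub>R J y"
        using FK[OF xy(1)] FK[OF xy(2)] by (simp only: add scale V.subspace_scale[OF K])
      then have "x + scale (-1) y = 0"
        using FK[OF xy(1)] FK[OF xy(2)] xy(3) by (intro inj V.subspace_add[OF K] V.subspace_scale[OF K]) simp_all
      then show "x = y" by simp
    qed
    have "independent (J ` F)"
    proof
      assume "dependent (J ` F)"
      then obtain u where u: "\<exists>v\<in>J ` F. u v \<noteq> 0" "(\<Sum>v\<in>J ` F. u v *\<^sub>R v) = 0"
        using F(1) by (auto simp: dependent_finite)
      have "J (\<Sum>x\<in>F. scale (u (J x)) x) = 0"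
        using u(2) by (simp add: sum sum.reindex[OF injF])
      then have "(\<Sum>x\<in>F. scale (u (J x)) x) = 0"
        using FK by (intro inj V.subspace_sum[OF K] V.subspace_scale[OF K])
      moreover have "\<exists>x\<in>F. u (J x) \<noteq> 0"
        using u(1) by auto
      ultimately have "V.dependent F"
        using F(1) by (auto simp: V.dependent_finite)
      then show False
        using B(2) F(2) V.independent_mono by blast
    qed
    then have "card (J ` F) \<le> dim W"
      using W F B(1) by (intro independent_card_le_dim) auto
    then show ?thesis by (simp add: card_image[OF injF])
  qed
  have "finite B"
  proof (rule ccontr)
    assume "infinite B"
    then obtain F where "finite F" "F \<subseteq> B" "card F = Suc (dim W)"
      using infinite_arbitrarily_large by metis
    then show False using le[of F] by simp
  qed
  then show ?thesis
    using B le[of B] by auto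
qed

abbreviation pair_class :: "'n \<times> 'n \<Rightarrow> 'n multiset" where
  "pair_class \<equiv> \<lambda>(i, j). {#i, j#}"

abbreviation triple_class :: "'n \<times> 'n \<times> 'n \<Rightarrow> 'n multiset" where
  "triple_class \<equiv> \<lambda>(i, j, k). {#i, j, k#}"

lemma range_pair_class: "range pair_class = multisets_of_size UNIV 2"
proof -
  have "M \<in> range pair_class" if "size M = 2" for M
  proof -
    obtain xs where "mset xs = M" using ex_mset by blast
    with that obtain i j where "M = {#i, j#}"
      by (auto simp: numeral_2_eq_2 length_Suc_conv)
    then show ?thesis by (auto intro: image_eqI[of _ _ "(i, j)"])
  qed
  then show ?thesis by (auto simp: multisets_of_size_def)
qed

lemma range_triple_class: "range triple_class = multisets_of_size UNIV 3"
proof -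
  have "M \<in> range triple_class" if "size M = 3" for M
  proof -
    obtain xs where "mset xs = M" using ex_mset by blast
    with that obtain i j k where "M = {#i, j, k#}"
      by (auto simp: numeral_3_eq_3 length_Suc_conv)
    then show ?thesis by (auto intro: image_eqI[of _ _ "(i, j, k)"])
  qed
  then show ?thesis by (auto simp: multisets_of_size_def)
qed

lemma card_range_pair_class: "card (range (pair_class :: 'n::finite \<times> 'n \<Rightarrow> _)) = (CARD('n) + 1) choose 2"
  by (simp add: range_pair_class card_multisets_of_size)

lemma card_range_triple_class: "card (range (triple_class :: 'n::finite \<times> 'n \<times> 'n \<Rightarrow> _)) = (CARD('n) + 2) choose 3"
  by (simp add: range_triple_class card_multisets_of_size)

lemma range_map_prod: "range (map_prod f g) = range f \<times> range g"
  by auto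

lemma sum_UNIV_prod: "(\<Sum>p\<in>UNIV. f p) = (\<Sum>a\<in>UNIV. \<Sum>b\<in>UNIV. f (a, b))"
  for f :: "'a::finite \<times> 'b::finite \<Rightarrow> real"
  unfolding UNIV_Times_UNIV[symmetric] sum.cartesian_product by simp

text \<open>
  Pairing with a symmetric tensor sees only the cyclic sum; a tensor with vanishing cyclic sums is
  therefore orthogonal to all symmetric ones.
\<close>

lemma sum_symmetric_times:
  fixes s b :: "'n::finite \<Rightarrow> 'n \<Rightarrow> 'n \<Rightarrow> real"
  assumes "\<And>i j k. s i j k = s j i k" "\<And>i j k. s i j k = s i k j"
  shows "3 * (\<Sum>i\<in>UNIV. \<Sum>j\<in>UNIV. \<Sum>k\<in>UNIV. s i j k * b i j k)
    = (\<Sum>i\<in>UNIV. \<Sum>j\<in>UNIV. \<Sum>k\<in>UNIV. s i j k * (b i j k + b j i k + b k i j))"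
proof -
  have "(\<Sum>i\<in>UNIV. \<Sum>j\<in>UNIV. \<Sum>k\<in>UNIV. s i j k * b j i k)
      = (\<Sum>i\<in>UNIV. \<Sum>j\<in>UNIV. \<Sum>k\<in>UNIV. s i j k * b i j k)"
    by (subst sum.swap) (simp add: assms(1))
  moreover have "(\<Sum>i\<in>UNIV. \<Sum>j\<in>UNIV. \<Sum>k\<in>UNIV. s i j k * b k i j)
      = (\<Sum>i\<in>UNIV. \<Sum>j\<in>UNIV. \<Sum>k\<in>UNIV. s i j k * b i j k)"
  proof -
    have "(\<Sum>i\<in>UNIV. \<Sum>j\<in>UNIV. \<Sum>k\<in>UNIV. s i j k * b k i j)
        = (\<Sum>i\<in>UNIV. \<Sum>k\<in>UNIV. \<Sum>j\<in>UNIV. s i j k * b k i j)"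
      by (subst sum.swap) (rule refl)
    also have "\<dots> = (\<Sum>k\<in>UNIV. \<Sum>i\<in>UNIV. \<Sum>j\<in>UNIV. s i j k * b k i j)"
      by (rule sum.swap)
    also have "\<dots> = (\<Sum>k\<in>UNIV. \<Sum>i\<in>UNIV. \<Sum>j\<in>UNIV. s k i j * b k i j)"
      by (intro sum.cong refl arg_cong2[of _ _ _ _ "(*)"]) (rule trans[OF assms(2) assms(1)])
    finally show ?thesis .
  qed
  ultimately show ?thesis
    by (simp add: distrib_left sum.distrib)
qed

text \<open>
  The possible values \<open>\<partial>\<^sub>k \<alpha>\<^sub>i\<^sub>j\<close>, at index \<open>(k, i, j)\<close>, for a Killing tensor \<open>\<alpha>\<close> with constant trace in
  Euclidean space.
\<close>

definition first_jets :: "(real^('n::finite \<times> 'n \<times> 'n)) set" where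
  "first_jets = {b. (\<forall>k i j. b $ (k, i, j) = b $ (k, j, i)) \<and>
     (\<forall>i j k. b $ (i, j, k) + b $ (j, i, k) + b $ (k, i, j) = 0) \<and>
     (\<forall>k. (\<Sum>i\<in>UNIV. b $ (k, i, i)) = 0)}"

text \<open>
  The possible values \<open>\<partial>\<^sub>l \<partial>\<^sub>k \<alpha>\<^sub>i\<^sub>j\<close>, at index \<open>(l, k, i, j)\<close>, for a Killing tensor \<open>\<alpha>\<close> with constant
  trace in Euclidean space.
\<close>

definition second_jets :: "(real^('n::finite \<times> 'n \<times> 'n \<times> 'n)) set" where
  "second_jets = {c. (\<forall>l k i j. c $ (l, k, i, j) = c $ (k, l, i, j)) \<and>
     (\<forall>l k i j. c $ (l, k, i, j) = c $ (l, k, j, i)) \<and>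
     (\<forall>l i j k. c $ (l, i, j, k) + c $ (l, j, i, k) + c $ (l, k, i, j) = 0) \<and>
     (\<forall>l k. (\<Sum>i\<in>UNIV. c $ (l, k, i, i)) = 0)}"

lemma subspace_first_jets: "subspace (first_jets :: (real^('n::finite \<times> 'n \<times> 'n)) set)"
proof (rule subspaceI)
  fix x y :: "real^('n \<times> 'n \<times> 'n)" and r :: real
  assume x: "x \<in> first_jets"
  have cyc: "(x + y) $ (i, j, k) + (x + y) $ (j, i, k) + (x + y) $ (k, i, j)
      = (x $ (i, j, k) + x $ (j, i, k) + x $ (k, i, j)) + (y $ (i, j, k) + y $ (j, i, k) + y $ (k, i, j))"
    "(r *\<^sub>R x) $ (i, j, k) + (r *\<^sub>R x) $ (j, i, k) + (r *\<^sub>R x) $ (k, i, j)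
      = r * (x $ (i, j, k) + x $ (j, i, k) + x $ (k, i, j))" for i j k
    by (simp_all add: algebra_simps)
  show "x + y \<in> first_jets" if "y \<in> first_jets"
    using x that unfolding first_jets_def mem_Collect_eq cyc by (simp add: sum.distrib)
  show "r *\<^sub>R x \<in> first_jets"
    using x unfolding first_jets_def mem_Collect_eq cyc by (simp add: sum_distrib_left[symmetric])
qed (simp add: first_jets_def)

lemma subspace_second_jets: "subspace (second_jets :: (real^('n::finite \<times> 'n \<times> 'n \<times> 'n)) set)"
proof (rule subspaceI)
  fix x y :: "real^('n \<times> 'n \<times> 'n \<times> 'n)" and r :: real
  assume x: "x \<in> second_jets"
  have cyc: "(x + y) $ (l, i, j, k) + (x + y) $ (l, j, i, k) + (x + y) $ (l, k, i, j)
      = (x $ (l, i, j, k) + x $ (l, j, i, k) + x $ (l, k, i, j))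
        + (y $ (l, i, j, k) + y $ (l, j, i, k) + y $ (l, k, i, j))"
    "(r *\<^sub>R x) $ (l, i, j, k) + (r *\<^sub>R x) $ (l, j, i, k) + (r *\<^sub>R x) $ (l, k, i, j)
      = r * (x $ (l, i, j, k) + x $ (l, j, i, k) + x $ (l, k, i, j))" for l i j k
    by (simp_all add: algebra_simps)
  have sw: "z $ (l, k, i, j) = z $ (k, l, i, j)" "z $ (l, k, i, j) = z $ (l, k, j, i)"
    if "z \<in> second_jets" for z :: "real^('n \<times> 'n \<times> 'n \<times> 'n)" and l k i j
    using that unfolding second_jets_def by blast+
  have eqs: "z $ (l, i, j, k) + z $ (l, j, i, k) + z $ (l, k, i, j) = 0" "(\<Sum>i\<in>UNIV. z $ (l, k, i, i)) = 0"
    if "z \<in> second_jets" for z :: "real^('n \<times> 'n \<times> 'n \<times> 'n)" and l k i j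
    using that unfolding second_jets_def by blast+
  show "x + y \<in> second_jets" if y: "y \<in> second_jets"
    unfolding second_jets_def mem_Collect_eq cyc
    by (simp add: eqs[OF x] eqs[OF y] sum.distrib sw[OF x] sw[OF y])
  show "r *\<^sub>R x \<in> second_jets"
    unfolding second_jets_def mem_Collect_eq cyc
    by (simp add: eqs[OF x] sum_distrib_left[symmetric] sw[OF x])
qed (simp add: second_jets_def)

text \<open>
  The constraints are dual to pairs of a symmetric 3-tensor \<open>s\<close> and a vector \<open>t\<close>, embedded as
  \<open>s\<^sub>k\<^sub>i\<^sub>j + t\<^sub>k \<delta>\<^sub>i\<^sub>j\<close>.  If this tensor is zero, then for \<open>i \<noteq> k\<close> both \<open>s\<^sub>k\<^sub>i\<^sub>i = - t\<^sub>k\<close> and \<open>s\<^sub>i\<^sub>k\<^sub>i = 0\<close>, so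
  \<open>t = 0\<close> and \<open>s = 0\<close>.  For \<open>n = 1\<close> there is no such \<open>i\<close>, and only \<open>t = 0\<close> is admitted.
\<close>

lemma dim_first_jets:
  "dim (first_jets :: (real^('n::finite \<times> 'n \<times> 'n)) set) + ((CARD('n) + 2) choose 3)
     + (if CARD('n) = 1 then 0 else CARD('n)) \<le> CARD('n) * ((CARD('n) + 1) choose 2)"
proof -
  define T where "T = (if CARD('n) = 1 then {0} else UNIV :: (real^'n) set)"
  define B where "B = fibre_constant (map_prod (id :: 'n \<Rightarrow> 'n) (pair_class :: 'n \<times> 'n \<Rightarrow> _))"
  define S where "S = fibre_constant (triple_class :: 'n \<times> 'n \<times> 'n \<Rightarrow> _)"
  define L :: "(real^('n \<times> 'n \<times> 'n)) \<times> (real^'n) \<Rightarrow> real^('n \<times> 'n \<times> 'n)"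
    where "L = (\<lambda>(s, t). s + (\<chi> p. case p of (k, i, j) \<Rightarrow> if i = j then t $ k else 0))"
  have L: "L (s, t) $ (k, i, j) = s $ (k, i, j) + (if i = j then t $ k else 0)" for s t k i j
    by (simp add: L_def)
  have T: "subspace T" "dim T = (if CARD('n) = 1 then 0 else CARD('n))"
    by (auto simp: T_def dim_UNIV)
  have S: "s $ (i, j, k) = s $ (j, i, k)" "s $ (i, j, k) = s $ (i, k, j)" if "s \<in> S" for s i j k
    using that fibre_constantD[of s triple_class "(i, j, k)" "(j, i, k)"]
      fibre_constantD[of s triple_class "(i, j, k)" "(i, k, j)"]
    unfolding S_def by (simp_all add: add_mset_commute)
  have "dim (first_jets :: (real^('n::finite \<times> 'n \<times> 'n)) set) + dim (S \<times> T) \<le> dim B"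
  proof (rule dim_annihilator_le)
    show "linear L"
      by (rule linearI) (auto simp: L_def vec_eq_iff algebra_simps)
    show "subspace (S \<times> T)" "subspace B"
      using T(1) by (auto simp: S_def B_def subspace_fibre_constant intro: subspace_Times)
    have inB: "w \<in> B" if "\<And>k i j. w $ (k, i, j) = w $ (k, j, i)" for w
      using that by (auto simp: B_def fibre_constant_def add_eq_conv_ex)
    show "L x \<in> B" if xP: "x \<in> S \<times> T" for x
    proof -
      obtain s t where st: "x = (s, t)" "s \<in> S" "t \<in> T" using xP by auto
      show ?thesis
        unfolding st(1) by (rule inB) (auto simp: L S[OF st(2)])
    qed
    show "first_jets \<subseteq> B"
      by (intro subsetI inB) (auto simp: first_jets_def)
    show "x = 0" if xP: "x \<in> S \<times> T" and Lx: "L x = 0" for x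
    proof -
      obtain s t where st: "x = (s, t)" "s \<in> S" "t \<in> T" using xP by auto
      have eq: "s $ (k, i, j) + (if i = j then t $ k else 0) = 0" for k i j
        using Lx by (simp add: st L[symmetric])
      have "t $ k = 0" for k
      proof (cases "CARD('n) = 1")
        case True
        then show ?thesis using st by (simp add: T_def)
      next
        case False
        then obtain i where "i \<noteq> k"
          by (metis (full_types) UNIV_eq_I card_1_singleton_iff insertCI singletonD One_nat_def)
        then show ?thesis
          using eq[of k i i] eq[of i k i] S(1)[OF st(2), of k i i] by simp
      qed
      moreover from this have "s $ (k, i, j) = 0" for k i j
        using eq[of k i j] by (cases "i = j") simp_all
      ultimately have "s = 0" "t = 0"
        by (simp_all add: vec_eq_iff)
      then show ?thesis
        by (simp add: st zero_prod_def)
    qed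
    show "L x \<bullet> w = 0" if w: "w \<in> first_jets" and xP: "x \<in> S \<times> T" for w x
    proof -
      obtain s t where st: "x = (s, t)" "s \<in> S" "t \<in> T" using xP by auto
      have w: "w $ (i, j, k) + w $ (j, i, k) + w $ (k, i, j) = 0" "(\<Sum>i\<in>UNIV. w $ (k, i, i)) = 0" for i j k
        using w unfolding first_jets_def by blast+
      have "L x \<bullet> w = (\<Sum>k\<in>UNIV. \<Sum>i\<in>UNIV. \<Sum>j\<in>UNIV. s $ (k, i, j) * w $ (k, i, j))
          + (\<Sum>k\<in>UNIV. t $ k * (\<Sum>i\<in>UNIV. w $ (k, i, i)))"
        by (simp add: st inner_vec_def sum_UNIV_prod L distrib_right sum.distrib sum_distrib_left
            if_distrib[of "\<lambda>t. t * _"] cong: if_cong)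
      moreover have "3 * (\<Sum>k\<in>UNIV. \<Sum>i\<in>UNIV. \<Sum>j\<in>UNIV. s $ (k, i, j) * w $ (k, i, j)) = 0"
        by (subst sum_symmetric_times) (simp_all only: S[OF st(2)] w(1) mult_zero_right sum.neutral_const)
      ultimately show ?thesis by (simp add: w)
    qed
  qed
  moreover have "dim (S \<times> T) = ((CARD('n) + 2) choose 3) + dim T"
    using T by (subst dim_Times) (auto simp: S_def subspace_fibre_constant dim_fibre_constant card_range_triple_class)
  moreover have "dim B = CARD('n) * ((CARD('n) + 1) choose 2)"
    unfolding B_def by (simp only: dim_fibre_constant range_map_prod card_cartesian_product card_range_pair_class) simp
  ultimately show ?thesis using T(2) by simp
qed

text \<open>
  Injectivity of the transposed constraints \<open>(u, v) \<mapsto> u\<^sub>k\<^sub>l\<^sub>i\<^sub>j + u\<^sub>l\<^sub>k\<^sub>i\<^sub>j + v\<^sub>k\<^sub>l \<delta>\<^sub>i\<^sub>j\<close>.  Once \<open>v = 0\<close>, the tensor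
  \<open>u\<close> is antisymmetric in its first two and symmetric in its last three indices, hence zero.  In
  dimension at least 3, \<open>v\<close> vanishes since three distinct indices are available.  In dimension 2 only
  the trace of \<open>v\<close> is forced to vanish: every trace-free \<open>v\<close> occurs in the kernel.  Restricting \<open>v\<close> to
  multiples of one diagonal unit restores injectivity.
\<close>

lemma second_jet_constraints_independent:
  fixes u :: "'n::finite \<Rightarrow> 'n \<Rightarrow> 'n \<Rightarrow> 'n \<Rightarrow> real" and v :: "'n \<Rightarrow> 'n \<Rightarrow> real"
  assumes u: "\<And>l i j k. u l i j k = u l j i k" "\<And>l i j k. u l i j k = u l i k j"
    and eq: "\<And>k l i j. u k l i j + u l k i j + (if i = j then v k l else 0) = 0"
    and v: "CARD('n) = 1 \<Longrightarrow> \<forall>k l. v k l = 0"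
      "CARD('n) = 2 \<Longrightarrow> \<exists>p. \<forall>k l. (k, l) \<noteq> (p, p) \<longrightarrow> v k l = 0"
  shows "u k l i j = 0 \<and> v k l = 0"
proof -
  \<comment> \<open>With last indices \<open>j, j\<close> the equation reads \<open>v\<^sub>l\<^sub>i = - u\<^sub>l\<^sub>i\<^sub>j\<^sub>j - u\<^sub>i\<^sub>l\<^sub>j\<^sub>j\<close>; the equations with distinct last
    indices carry no \<open>v\<close> and move \<open>j\<close> to the front of both terms.\<close>
  have v_eq: "v l i = u j j l i + u j j l i" if "j \<noteq> l" "j \<noteq> i" for l i j
  proof -
    have "u l i j j + u i l j j + v l i = 0"
      using eq[of l i j j] by simp
    moreover have "u l j i j + u j l i j = 0" "u i j l j + u j i l j = 0"
      using eq[of l j i j] eq[of i j l j] that by simp_all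
    ultimately show ?thesis
      using u(1)[of l i j j] u(1)[of i l j j] u(1)[of j l i j] u(2)[of j i l j] u(2)[of j l i j]
        u(1)[of j i l j] u(1)[of j l j i] u(1)[of j i j l] u(2)[of j j l i] by linarith
  qed
  have diag: "v l l = - v j j" if "j \<noteq> l" for j l
    using v_eq[of j l l] eq[of j j l l] that by simp
  have v0: "v k l = 0" for k l
  proof -
    consider "CARD('n) = 1" | "CARD('n) = 2" | "CARD('n) \<ge> 3"
      using zero_less_card_finite[where 'a='n] by linarith
    then show ?thesis
    proof cases
      case 1
      then show ?thesis using v(1) by blast
    next
      case 2
      then obtain p where p: "\<And>k l. (k, l) \<noteq> (p, p) \<Longrightarrow> v k l = 0"
        using v(2) by blast
      have "\<exists>q. q \<noteq> p"
      proof (rule ccontr)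
        assume "\<not> ?thesis"
        then have "(UNIV :: 'n set) = {p}" by auto
        then have "CARD('n) = card {p}" by (simp only:)
        with 2 show False by simp
      qed
      then obtain q where "q \<noteq> p" ..
      then have "v p p = 0"
        using diag[of q p] p[of q q] by simp
      then show ?thesis using p[of k l] by (cases "(k, l) = (p, p)") auto
    next
      case 3
      have ex: "\<exists>j. j \<noteq> k \<and> j \<noteq> l" for k l :: 'n
      proof (rule ccontr)
        assume "\<not> ?thesis"
        then have "(UNIV :: 'n set) \<subseteq> {k, l}" by auto
        then have "CARD('n) \<le> card {k, l}" by (intro card_mono) auto
        also have "\<dots> \<le> 2" by (simp add: card_insert_if)
        finally show False using 3 by simp
      qed
      show ?thesis
      proof (cases "k = l")
        case True
        obtain a where a: "a \<noteq> l" using ex by blast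
        obtain b where b: "b \<noteq> a" "b \<noteq> l" using ex by blast
        show ?thesis
          using diag[OF a] diag[OF b(1)] diag[OF b(2)] True by simp
      next
        case False
        obtain j where j: "j \<noteq> k" "j \<noteq> l" using ex by blast
        show ?thesis
          using v_eq[OF j] eq[of j j k l] False by simp
      qed
    qed
  qed
  have anti: "u k l i j = - u l k i j" for k l i j
    using eq[of k l i j] v0[of k l] by (cases "i = j") simp_all
  \<comment> \<open>Swapping places 1, 2 and places 2, 3 alternately, three times each, restores the order of the
    indices; each swap of places 1, 2 changes the sign.\<close>
  have "u k l i j = - u k l i j" for k l i j
    using anti[of k l i j] u(1)[of l k i j] anti[of l i k j] u(1)[of i l k j] anti[of i k l j] u(1)[of k i l j]
    by linarith
  then have "u k l i j = 0" by (metis equal_neg_zero)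
  with v0 show ?thesis by simp
qed

text \<open>
  The transposed constraints are parametrised by \<open>u\<close> in \<open>V \<otimes> Sym\<^sup>3 V\<close> and \<open>v\<close> in \<open>Sym\<^sup>2 V\<close>, where in
  dimensions 1 and 2 the second space is shrunk until the parametrisation is injective.
\<close>

lemma dim_second_jets:
  "dim (second_jets :: (real^('n::finite \<times> 'n \<times> 'n \<times> 'n)) set) + CARD('n) * ((CARD('n) + 2) choose 3)
     + (if CARD('n) = 1 then 0 else if CARD('n) = 2 then 1 else (CARD('n) + 1) choose 2)
   \<le> ((CARD('n) + 1) choose 2) * ((CARD('n) + 1) choose 2)"
proof -
  define p where "p = (undefined :: 'n)"
  define V where "V = (if CARD('n) = 1 then {0} else if CARD('n) = 2 then span {axis (p, p) 1}
      else fibre_constant pair_class :: (real^('n \<times> 'n)) set)"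
  define B where "B = fibre_constant ((\<lambda>(k, l, i, j). (pair_class (k, l), pair_class (i, j)))
      :: 'n \<times> 'n \<times> 'n \<times> 'n \<Rightarrow> _)"
  define S where "S = fibre_constant (map_prod id triple_class :: 'n \<times> 'n \<times> 'n \<times> 'n \<Rightarrow> 'n \<times> _)"
  define L :: "(real^('n \<times> 'n \<times> 'n \<times> 'n)) \<times> (real^('n \<times> 'n)) \<Rightarrow> real^('n \<times> 'n \<times> 'n \<times> 'n)"
    where "L = (\<lambda>(u, v). \<chi> q. case q of (k, l, i, j) \<Rightarrow>
        u $ (k, l, i, j) + u $ (l, k, i, j) + (if i = j then v $ (k, l) else 0))"
  have L: "L (u, v) $ (k, l, i, j) = u $ (k, l, i, j) + u $ (l, k, i, j) + (if i = j then v $ (k, l) else 0)"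
    for u v k l i j
    by (simp add: L_def)
  have V: "subspace V" "dim V = (if CARD('n) = 1 then 0 else if CARD('n) = 2 then 1 else (CARD('n) + 1) choose 2)"
    by (auto simp: V_def subspace_fibre_constant subspace_span dim_fibre_constant card_range_pair_class axis_eq_0_iff)
  have Vsym: "v $ (k, l) = v $ (l, k)" if "v \<in> V" for v k l
  proof (cases "CARD('n) = 1 \<or> CARD('n) = 2")
    case True
    then show ?thesis using that by (auto simp: V_def span_singleton axis_def split: if_splits)
  next
    case False
    then show ?thesis
      using that fibre_constantD[of v pair_class "(k, l)" "(l, k)"] by (simp add: V_def add_mset_commute)
  qed
  have S: "u $ (l, i, j, k) = u $ (l, j, i, k)" "u $ (l, i, j, k) = u $ (l, i, k, j)" if "u \<in> S" for u l i j k
    using that fibre_constantD[of u "map_prod id triple_class" "(l, i, j, k)" "(l, j, i, k)"]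
      fibre_constantD[of u "map_prod id triple_class" "(l, i, j, k)" "(l, i, k, j)"]
    unfolding S_def by (simp_all add: add_mset_commute)
  have "dim (second_jets :: (real^('n \<times> 'n \<times> 'n \<times> 'n)) set) + dim (S \<times> V) \<le> dim B"
  proof (rule dim_annihilator_le)
    show "linear L"
      by (rule linearI) (auto simp: L_def vec_eq_iff algebra_simps)
    show "subspace (S \<times> V)" "subspace B"
      using V(1) by (auto simp: S_def B_def subspace_fibre_constant intro: subspace_Times)
    have inB: "w \<in> B" if "\<And>k l i j. w $ (k, l, i, j) = w $ (l, k, i, j)" "\<And>k l i j. w $ (k, l, i, j) = w $ (k, l, j, i)" for w
      using that by (auto simp: B_def fibre_constant_def add_eq_conv_ex)
    show "L x \<in> B" if xP: "x \<in> S \<times> V" for x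
    proof -
      obtain u v where uv: "x = (u, v)" "u \<in> S" "v \<in> V" using xP by auto
      show ?thesis
        unfolding uv(1) by (rule inB) (auto simp: L Vsym[OF uv(3)] S[OF uv(2)])
    qed
    show "second_jets \<subseteq> B"
      by (intro subsetI inB) (auto simp: second_jets_def)
    show "x = 0" if xP: "x \<in> S \<times> V" and Lx: "L x = 0" for x
    proof -
      obtain u v where uv: "x = (u, v)" "u \<in> S" "v \<in> V" using xP by auto
      have eq: "u $ (k, l, i, j) + u $ (l, k, i, j) + (if i = j then v $ (k, l) else 0) = 0" for k l i j
        using Lx by (simp add: uv L[symmetric])
      have "u $ (k, l, i, j) = 0 \<and> v $ (k, l) = 0" for k l i j
      proof (rule second_jet_constraints_independent[of "\<lambda>l i j k. u $ (l, i, j, k)" "\<lambda>k l. v $ (k, l)"])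
        show "\<forall>k l. v $ (k, l) = 0" if "CARD('n) = 1"
          using uv(3) that by (simp add: V_def)
        show "\<exists>p. \<forall>k l. (k, l) \<noteq> (p, p) \<longrightarrow> v $ (k, l) = 0" if "CARD('n) = 2"
          using uv(3) that by (intro exI[of _ p]) (auto simp: V_def span_singleton axis_def)
      qed (rule S[OF uv(2)] eq)+
      then have "u = 0" "v = 0"
        by (simp_all add: vec_eq_iff)
      then show ?thesis
        by (simp add: uv zero_prod_def)
    qed
    show "L x \<bullet> w = 0" if w: "w \<in> second_jets" and xP: "x \<in> S \<times> V" for w x
    proof -
      obtain u v where uv: "x = (u, v)" "u \<in> S" "v \<in> V" using xP by auto
      have w: "w $ (l, i, j, k) + w $ (l, j, i, k) + w $ (l, k, i, j) = 0" "(\<Sum>i\<in>UNIV. w $ (l, k, i, i)) = 0"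
        "w $ (l, k, i, j) = w $ (k, l, i, j)" for l i j k
        using w unfolding second_jets_def by blast+
      let ?P = "\<Sum>k\<in>UNIV. \<Sum>l\<in>UNIV. \<Sum>i\<in>UNIV. \<Sum>j\<in>UNIV. u $ (k, l, i, j) * w $ (k, l, i, j)"
      have "?P = 0"
      proof (rule sum.neutral, rule ballI)
        fix k
        have "3 * (\<Sum>l\<in>UNIV. \<Sum>i\<in>UNIV. \<Sum>j\<in>UNIV. u $ (k, l, i, j) * w $ (k, l, i, j)) = 0"
          by (subst sum_symmetric_times) (simp_all only: S[OF uv(2)] w(1) mult_zero_right sum.neutral_const)
        then show "(\<Sum>l\<in>UNIV. \<Sum>i\<in>UNIV. \<Sum>j\<in>UNIV. u $ (k, l, i, j) * w $ (k, l, i, j)) = 0" by simp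
      qed
      moreover have "(\<Sum>k\<in>UNIV. \<Sum>l\<in>UNIV. \<Sum>i\<in>UNIV. \<Sum>j\<in>UNIV. u $ (l, k, i, j) * w $ (k, l, i, j)) = ?P"
        by (rule trans[OF sum.swap]) (intro sum.cong refl arg_cong2[of _ _ _ _ "(*)"] w(3))
      moreover have "(\<Sum>k\<in>UNIV. \<Sum>l\<in>UNIV. \<Sum>i\<in>UNIV. \<Sum>j\<in>UNIV. (if i = j then v $ (k, l) else 0) * w $ (k, l, i, j))
          = (\<Sum>k\<in>UNIV. \<Sum>l\<in>UNIV. v $ (k, l) * (\<Sum>i\<in>UNIV. w $ (k, l, i, i)))"
        by (simp add: sum_distrib_left if_distrib[of "\<lambda>t. t * _"] cong: if_cong)
      ultimately show ?thesis
        by (simp add: uv inner_vec_def sum_UNIV_prod L distrib_right sum.distrib w(2))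
    qed
  qed
  moreover have "dim (S \<times> V) = CARD('n) * ((CARD('n) + 2) choose 3) + dim V"
  proof -
    have "dim S = CARD('n) * ((CARD('n) + 2) choose 3)"
      unfolding S_def by (simp only: dim_fibre_constant range_map_prod card_cartesian_product card_range_triple_class) simp
    then show ?thesis
      using V by (subst dim_Times) (auto simp: S_def subspace_fibre_constant)
  qed
  moreover have "dim B = ((CARD('n) + 1) choose 2) * ((CARD('n) + 1) choose 2)"
  proof -
    have "range ((\<lambda>(k, l, i, j). (pair_class (k, l), pair_class (i, j))) :: 'n \<times> 'n \<times> 'n \<times> 'n \<Rightarrow> _)
        = range pair_class \<times> range pair_class"
    proof (intro equalityI subsetI)
      fix x :: "'n multiset \<times> 'n multiset" assume "x \<in> range pair_class \<times> range pair_class"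
      then obtain a b c d where "x = ({#a, b#}, {#c, d#})" by auto
      then show "x \<in> range (\<lambda>(k, l, i, j). (pair_class (k, l), pair_class (i, j)))"
        by (intro image_eqI[of _ _ "(a, b, c, d)"]) simp_all
    qed auto
    then show ?thesis
      unfolding B_def by (simp only: dim_fibre_constant card_cartesian_product card_range_pair_class)
  qed
  ultimately show ?thesis using V(2) by simp
qed

text \<open>
  For \<open>n \<ge> 3\<close> the bound is
  \<open>[t] + [n t - s - n] + [t\<^sup>2 - n s - t]\<close> with \<open>t = (n + 1) choose 2\<close> and \<open>s = (n + 2) choose 3\<close>, the brackets
  being the dimensions for the orders 0, 1 and 2.
\<close>

lemma jet_dimension_bound:
  "real (((CARD('n::finite) + 1) choose 2) + dim (first_jets :: (real^('n \<times> 'n \<times> 'n)) set)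
     + dim (second_jets :: (real^('n \<times> 'n \<times> 'n \<times> 'n)) set)) \<le> K0_2 CARD('n)"
proof -
  define n where "n = CARD('n)"
  have n: "n > 0" by (simp add: n_def)
  have b2: "real ((n + 1) choose 2) = real n * (real n + 1) / 2"
  proof -
    have "2 * ((n + 1) choose 2) = (n + 1) * n"
      using binomial_absorption[of 1 "n + 1"] by (simp add: numeral_2_eq_2)
    then have "2 * real ((n + 1) choose 2) = (real n + 1) * real n"
      by (metis of_nat_mult of_nat_numeral of_nat_add of_nat_1)
    then show ?thesis by (simp only: field_simps)
  qed
  have b3: "real ((n + 2) choose 3) = real n * (real n + 1) * (real n + 2) / 6"
  proof -
    have "3 * ((n + 2) choose 3) = (n + 2) * ((n + 1) choose 2)"
      using binomial_absorption[of 2 "n + 2"] by (simp add: numeral_3_eq_3 numeral_2_eq_2)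
    then have "3 * real ((n + 2) choose 3) = (real n + 2) * real ((n + 1) choose 2)"
      by (metis of_nat_mult of_nat_numeral of_nat_add)
    then have "3 * real ((n + 2) choose 3) = (real n + 2) * (real n * (real n + 1) / 2)"
      by (simp only: b2)
    moreover have "X = N * (N + 1) * (N + 2) / 6" if "3 * X = (N + 2) * (N * (N + 1) / 2)" for X N :: real
      using that by (simp add: field_simps)
    ultimately show ?thesis by blast
  qed
  have d1: "real (dim (first_jets :: (real^('n \<times> 'n \<times> 'n)) set)) + real ((n + 2) choose 3)
      + (if n = 1 then 0 else real n) \<le> real n * real ((n + 1) choose 2)"
    using dim_first_jets[where 'n='n] unfolding n_def[symmetric] 
    by (simp del: of_nat_add of_nat_mult add: of_nat_add[symmetric] of_nat_mult[symmetric] split: if_splits)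
  have d2: "real (dim (second_jets :: (real^('n \<times> 'n \<times> 'n \<times> 'n)) set)) + real n * real ((n + 2) choose 3)
      + (if n = 1 then 0 else if n = 2 then 1 else real ((n + 1) choose 2)) \<le> real ((n + 1) choose 2) * real ((n + 1) choose 2)"
    using dim_second_jets[where 'n='n] unfolding n_def[symmetric]
    by (simp del: of_nat_add of_nat_mult add: of_nat_add[symmetric] of_nat_mult[symmetric] split: if_splits)
  define a where "a = dim (first_jets :: (real^('n \<times> 'n \<times> 'n)) set)"
  define b where "b = dim (second_jets :: (real^('n \<times> 'n \<times> 'n \<times> 'n)) set)"
  note d = d1[folded a_def] d2[folded b_def]
  have "real (((n + 1) choose 2) + a + b) \<le> K0_2 n"
  proof -
    consider "n = 1" | "n = 2" | "n \<ge> 3" using n by linarith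
    then show ?thesis
    proof cases
      case 1
      then show ?thesis using d unfolding of_nat_add b2 b3 by (simp add: K0_2_def)
    next
      case 2
      then show ?thesis using d unfolding of_nat_add b2 b3 by (simp add: K0_2_def)
    next
      case 3
      let ?t = "real n * (real n + 1) / 2" and ?s = "real n * (real n + 1) * (real n + 2) / 6"
      have "K0_2 n = ?t + (real n * ?t - ?s - real n) + (?t * ?t - real n * ?s - ?t)"
        using 3 unfolding K0_2_def b2 b3 by (simp add: field_simps power2_eq_square)
      then show ?thesis using d 3 unfolding b2 b3 of_nat_add by simp
    qed
  qed
  then show ?thesis by (simp only: n_def a_def b_def)
qed

section \<open>The jet map\<close>

lemma component_add: "component (\<alpha> + \<beta>) c i j = (\<lambda>y. component \<alpha> c i j y + component \<beta> c i j y)"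
  by (simp add: component_def)

lemma component_scale: "component (scale_tensor r \<alpha>) c i j = (\<lambda>y. r * component \<alpha> c i j y)"
  by (simp add: component_def scale_tensor_def)

lemma sym_tensors_subspace:
  fixes A :: "('a, 'n::finite) chart set"
  assumes chart: "\<And>c. c \<in> A \<Longrightarrow> open (coord c ` cdom c)"
  shows "tensor.subspace (sym_tensors A p)"
proof (rule tensor.subspaceI)
  show "0 \<in> sym_tensors A p"
    by (simp add: sym_tensors_def covariant_tensor_def smooth_on_const)
  fix \<alpha> \<beta> :: "('a, 'n) tensor" and r :: real
  assume \<alpha>: "\<alpha> \<in> sym_tensors A p"
  show "\<alpha> + \<beta> \<in> sym_tensors A p" if \<beta>: "\<beta> \<in> sym_tensors A p"
  proof -
    have "covariant_tensor A p (\<alpha> + \<beta>)"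
      unfolding covariant_tensor_def
    proof (intro conjI allI ballI impI)
      fix c :: "('a, 'n) chart" and x and js :: "'n list" assume "\<not> (c \<in> A \<and> x \<in> cdom c \<and> length js = p)"
      then have "\<gamma> c x js = 0" if "\<gamma> \<in> sym_tensors A p" for \<gamma>
        using that unfolding sym_tensors_def covariant_tensor_def by blast
      from this[OF \<alpha>] this[OF \<beta>] show "(\<alpha> + \<beta>) c x js = 0"
        by simp
    next
      fix c d x and js :: "'n list" assume c: "c \<in> A" "d \<in> A" "x \<in> cdom c \<inter> cdom d" "length js = p"
      have "\<gamma> c x js = (\<Sum>is | length is = p. (\<Prod>k<p. jacobian c d x (is ! k) (js ! k)) * \<gamma> d x is)"
        if "\<gamma> \<in> sym_tensors A p" for \<gamma>
        using that c unfolding sym_tensors_def covariant_tensor_def by blast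
      from this[OF \<alpha>] this[OF \<beta>]
      show "(\<alpha> + \<beta>) c x js = (\<Sum>is | length is = p. (\<Prod>k<p. jacobian c d x (is ! k) (js ! k)) * (\<alpha> + \<beta>) d x is)"
        by (simp add: distrib_left sum.distrib)
    next
      fix c and js :: "'n list" assume c: "c \<in> A"
      have "smooth_on (coord c ` cdom c) (\<lambda>y. \<gamma> c (param c y) js)" if "\<gamma> \<in> sym_tensors A p" for \<gamma>
        using that c unfolding sym_tensors_def covariant_tensor_def by blast
      from smooth_on_add[OF chart[OF c] this[OF \<alpha>] this[OF \<beta>]]
      show "smooth_on (coord c ` cdom c) (\<lambda>y. (\<alpha> + \<beta>) c (param c y) js)" by simp
    qed
    moreover have "(\<alpha> + \<beta>) c x is = (\<alpha> + \<beta>) c x js" if "mset is = mset js" for c x "is" js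
    proof -
      have "\<alpha> c x is = \<alpha> c x js" "\<beta> c x is = \<beta> c x js"
        using \<alpha> \<beta> that unfolding sym_tensors_def by blast+
      then show ?thesis by simp
    qed
    ultimately show ?thesis
      unfolding sym_tensors_def by blast
  qed
  show "scale_tensor r \<alpha> \<in> sym_tensors A p"
  proof -
    have "covariant_tensor A p (scale_tensor r \<alpha>)"
      unfolding covariant_tensor_def scale_tensor_def
    proof (intro conjI allI ballI impI)
      fix c :: "('a, 'n) chart" and x and js :: "'n list" assume "\<not> (c \<in> A \<and> x \<in> cdom c \<and> length js = p)"
      then have "\<alpha> c x js = 0"
        using \<alpha> unfolding sym_tensors_def covariant_tensor_def by blast
      then show "r * \<alpha> c x js = 0" by simp
    next
      fix c d x and js :: "'n list" assume c: "c \<in> A" "d \<in> A" "x \<in> cdom c \<inter> cdom d" "length js = p"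
      have "\<alpha> c x js = (\<Sum>is | length is = p. (\<Prod>k<p. jacobian c d x (is ! k) (js ! k)) * \<alpha> d x is)"
        using \<alpha> c unfolding sym_tensors_def covariant_tensor_def by blast
      then show "r * \<alpha> c x js = (\<Sum>is | length is = p. (\<Prod>k<p. jacobian c d x (is ! k) (js ! k)) * (r * \<alpha> d x is))"
        by (simp add: sum_distrib_left mult_ac)
    next
      fix c and js :: "'n list" assume c: "c \<in> A"
      have "smooth_on (coord c ` cdom c) (\<lambda>y. \<alpha> c (param c y) js)"
        using \<alpha> c unfolding sym_tensors_def covariant_tensor_def by blast
      from smooth_on_mult[OF chart[OF c] smooth_on_const this]
      show "smooth_on (coord c ` cdom c) (\<lambda>y. r * \<alpha> c (param c y) js)" .
    qed
    moreover have "scale_tensor r \<alpha> c x is = scale_tensor r \<alpha> c x js" if "mset is = mset js" for c x "is" js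
    proof -
      have "\<alpha> c x is = \<alpha> c x js"
        using \<alpha> that unfolding sym_tensors_def by blast
      then show ?thesis by (simp add: scale_tensor_def)
    qed
    ultimately show ?thesis
      unfolding sym_tensors_def by blast
  qed
qed

lemma killing_2_tensors_subspace:
  assumes M: "smooth_manifold M A"
  shows "tensor.subspace (killing_2_tensors A g)"
proof -
  have sub: "tensor.subspace (sym_tensors A 2)"
    by (rule sym_tensors_subspace[OF chart_open[OF M]])
  have diff: "component \<alpha> c i j differentiable (at (coord c x))"
    if "\<alpha> \<in> sym_tensors A 2" "c \<in> A" "x \<in> cdom c" for \<alpha> c x i j
    using that by (intro smooth_on_differentiable[OF smooth_on_component]) auto
  have add: "killing_cyclic g c (\<alpha> + \<beta>) x i j k = killing_cyclic g c \<alpha> x i j k + killing_cyclic g c \<beta> x i j k"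
    if "\<alpha> \<in> sym_tensors A 2" "\<beta> \<in> sym_tensors A 2" "c \<in> A" "x \<in> cdom c" for \<alpha> \<beta> c x i j k
    using that unfolding killing_cyclic_def nabla_coord_pair component_add
    by (simp add: dir_deriv_add diff distrib_left sum.distrib)
  have scale: "killing_cyclic g c (scale_tensor r \<alpha>) x i j k = r * killing_cyclic g c \<alpha> x i j k"
    if "\<alpha> \<in> sym_tensors A 2" "c \<in> A" "x \<in> cdom c" for r \<alpha> c x i j k
    using that unfolding killing_cyclic_def nabla_coord_pair component_scale
    by (simp add: dir_deriv_cmult diff scale_tensor_def sum_distrib_left algebra_simps)
  have zero: "killing_cyclic g c 0 x i j k = 0" for c x i j k
    by (simp add: killing_cyclic_def nabla_coord_pair component_def dir_deriv_const)
  show ?thesis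
    by (rule tensor.subspaceI)
       (use sub in \<open>simp_all add: killing_2_tensors_def add scale zero tensor.subspace_0 tensor.subspace_add
          tensor.subspace_scale\<close>)
qed

definition jet_map :: "('a, 'n::finite) chart \<Rightarrow> 'a \<Rightarrow> ('a, 'n) tensor
    \<Rightarrow> (real^('n \<times> 'n)) \<times> (real^('n \<times> 'n \<times> 'n)) \<times> (real^('n \<times> 'n \<times> 'n \<times> 'n))" where
  "jet_map c x \<alpha> =
    (\<chi> p. case p of (i, j) \<Rightarrow> component \<alpha> c i j (coord c x),
     \<chi> p. case p of (k, i, j) \<Rightarrow> dir_deriv (axis k 1) (component \<alpha> c i j) (coord c x),
     \<chi> p. case p of (l, k, i, j) \<Rightarrow> dir_deriv (axis l 1) (dir_deriv (axis k 1) (component \<alpha> c i j)) (coord c x))"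

lemma jet_map_add:
  assumes M: "smooth_manifold M A" and c: "c \<in> A" "x \<in> cdom c"
    and \<alpha>: "\<alpha> \<in> sym_tensors A 2" and \<beta>: "\<beta> \<in> sym_tensors A 2"
  shows "jet_map c x (\<alpha> + \<beta>) = jet_map c x \<alpha> + jet_map c x \<beta>"
proof -
  let ?U = "coord c ` cdom c"
  have x: "coord c x \<in> ?U" using c by simp
  note sa = smooth_on_component[OF \<alpha> c(1)] and sb = smooth_on_component[OF \<beta> c(1)]
  have 1: "dir_deriv v (component (\<alpha> + \<beta>) c i j) y = dir_deriv v (component \<alpha> c i j) y + dir_deriv v (component \<beta> c i j) y"
    if "y \<in> ?U" for v i j y
    unfolding component_add
    by (intro dir_deriv_add smooth_on_differentiable[OF sa that] smooth_on_differentiable[OF sb that])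
  have 2: "dir_deriv w (dir_deriv v (component (\<alpha> + \<beta>) c i j)) (coord c x)
      = dir_deriv w (dir_deriv v (component \<alpha> c i j)) (coord c x) + dir_deriv w (dir_deriv v (component \<beta> c i j)) (coord c x)" for v w i j
  proof -
    have "dir_deriv w (dir_deriv v (component (\<alpha> + \<beta>) c i j)) (coord c x)
        = dir_deriv w (\<lambda>y. dir_deriv v (component \<alpha> c i j) y + dir_deriv v (component \<beta> c i j) y) (coord c x)"
      by (rule dir_deriv_cong[OF chart_open[OF M c(1)] x 1])
    also have "\<dots> = dir_deriv w (dir_deriv v (component \<alpha> c i j)) (coord c x) + dir_deriv w (dir_deriv v (component \<beta> c i j)) (coord c x)"
      by (intro dir_deriv_add smooth_on_differentiable[OF smooth_on_dir_deriv x] sa sb)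
    finally show ?thesis .
  qed
  have 0: "component (\<alpha> + \<beta>) c i j y = component \<alpha> c i j y + component \<beta> c i j y" for i j y
    by (simp add: component_add)
  show ?thesis
    by (simp add: jet_map_def vec_eq_iff 0 1[OF x] 2)
qed

lemma jet_map_scale:
  assumes M: "smooth_manifold M A" and c: "c \<in> A" "x \<in> cdom c"
    and \<alpha>: "\<alpha> \<in> sym_tensors A 2"
  shows "jet_map c x (scale_tensor r \<alpha>) = r *\<^sub>R jet_map c x \<alpha>"
proof -
  let ?U = "coord c ` cdom c"
  have x: "coord c x \<in> ?U" using c by simp
  note sa = smooth_on_component[OF \<alpha> c(1)]
  have 1: "dir_deriv v (component (scale_tensor r \<alpha>) c i j) y = r * dir_deriv v (component \<alpha> c i j) y"
    if "y \<in> ?U" for v i j y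
    unfolding component_scale by (intro dir_deriv_cmult smooth_on_differentiable[OF sa that])
  have 2: "dir_deriv w (dir_deriv v (component (scale_tensor r \<alpha>) c i j)) (coord c x)
      = r * dir_deriv w (dir_deriv v (component \<alpha> c i j)) (coord c x)" for v w i j
  proof -
    have "dir_deriv w (dir_deriv v (component (scale_tensor r \<alpha>) c i j)) (coord c x)
        = dir_deriv w (\<lambda>y. r * dir_deriv v (component \<alpha> c i j) y) (coord c x)"
      by (rule dir_deriv_cong[OF chart_open[OF M c(1)] x 1])
    also have "\<dots> = r * dir_deriv w (dir_deriv v (component \<alpha> c i j)) (coord c x)"
      by (intro dir_deriv_cmult smooth_on_differentiable[OF smooth_on_dir_deriv x] sa)
    finally show ?thesis .
  qed
  have 0: "component (scale_tensor r \<alpha>) c i j y = r * component \<alpha> c i j y" for i j y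
    by (simp add: component_scale)
  show ?thesis
    by (simp add: jet_map_def vec_eq_iff 0 1[OF x] 2)
qed

lemma jet_map_eq_0:
  fixes g :: "('a, 'n::finite) tensor"
  assumes "smooth_manifold M A" "connected_space M" "riemannian_metric A g" "c \<in> A" "x \<in> cdom c"
    and "\<alpha> \<in> killing_2_tensors A g" and "jet_map c x \<alpha> = 0"
  shows "\<alpha> = 0"
proof (rule killing_eq_0_if_jet_eq_0[OF assms(1-6)])
  fix i j k l
  have "fst (jet_map c x \<alpha>) $ (i, j) = 0" "fst (snd (jet_map c x \<alpha>)) $ (k, i, j) = 0"
    "snd (snd (jet_map c x \<alpha>)) $ (l, k, i, j) = 0"
    using assms(7) by simp_all
  then show "component \<alpha> c i j (coord c x) = 0" "dir_deriv (axis k 1) (component \<alpha> c i j) (coord c x) = 0"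
    "dir_deriv (axis l 1) (dir_deriv (axis k 1) (component \<alpha> c i j)) (coord c x) = 0"
    by (simp_all add: jet_map_def)
qed

section \<open>Jets in a flat chart\<close>

lemma christoffel_flat:
  assumes M: "smooth_manifold M A" and c: "c \<in> A" "x \<in> cdom c"
    and flat: "\<And>z i j. z \<in> cdom c \<Longrightarrow> g c z [i, j] = (if i = j then 1 else 0)"
  shows "christoffel g c x l k i = 0"
proof -
  have "pd c k (\<lambda>z. g c z [i, j]) x = 0" for k i j
  proof -
    have "dir_deriv v (component g c i j) (coord c x) = dir_deriv v (\<lambda>_. if i = j then 1 else 0 :: real) (coord c x)" for v
      using c by (intro dir_deriv_cong[OF chart_open[OF M c(1)]])
        (auto simp: component_def flat param_in_cdom[OF M c(1)] param_coord[OF M c(1)])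
    then show ?thesis
      by (simp add: pd_component dir_deriv_const)
  qed
  then show ?thesis by (simp add: christoffel_def)
qed

lemma flat_killing_equation:
  fixes g :: "('a, 'n::finite) tensor"
  assumes M: "smooth_manifold M A" and c: "c \<in> A"
    and flat: "\<And>z i j. z \<in> cdom c \<Longrightarrow> g c z [i, j] = (if i = j then 1 else 0)"
    and \<alpha>: "\<alpha> \<in> killing_2_tensors A g" and y: "y \<in> coord c ` cdom c"
  shows "dir_deriv (axis i 1) (component \<alpha> c j k) y + dir_deriv (axis j 1) (component \<alpha> c i k) y + dir_deriv (axis k 1) (component \<alpha> c i j) y = 0"
  using killing_component_equation[OF M c \<alpha> param_in_cdom[OF M c y], of i j k]
  by (simp add: coord_param[OF M c y] christoffel_flat[OF M c param_in_cdom[OF M c y], of g, OF flat])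

text \<open>
  In a flat chart the Euclidean coframe dual to an orthonormal frame is the frame itself, so the
  contraction over the frame is the contraction over coordinate indices.
\<close>

lemma flat_divergence_equation:
  fixes g :: "('a, 'n::finite) tensor"
  assumes M: "smooth_manifold M A" and g: "riemannian_metric A g" and c: "c \<in> A" "x \<in> cdom c"
    and flat: "\<And>z i j. z \<in> cdom c \<Longrightarrow> g c z [i, j] = (if i = j then 1 else 0)"
    and div: "divergence A g 2 \<alpha> = 0"
  shows "(\<Sum>i\<in>UNIV. dir_deriv (axis i 1) (component \<alpha> c i j) (coord c x)) = 0"
proof -
  define e where "e = (SOME e. orthonormal_frame g c x e)"
  have e: "orthonormal_frame g c x e"
    unfolding e_def using orthonormal_frame_exists[OF g c] by (rule someI_ex)
  have "metric_form g c x v w = v \<bullet> w" for v w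
    by (simp add: metric_form_def flat[OF c(2)] inner_vec_def if_distrib[of "\<lambda>t. t * _"] cong: if_cong)
  then have dual: "dual_coframe e a = e a" for a
    using dual_coframe_orthonormal[OF g c e, of a] vector_eq_rdot[of "dual_coframe e a" "e a"] by simp
  have orth: "(\<Sum>a\<in>UNIV. e a $ i * e a $ m) = (if i = m then 1 else 0)" for i m
    using frame_expansion[OF g c e, of i m] by (simp add: dual)
  have "0 = (\<Sum>a\<in>UNIV. interior_product (e a) (nabla g c (e a) \<alpha> x) [j])"
    using fun_cong[OF fun_cong[OF fun_cong[OF div]], of c x "[j]"] c
    by (simp add: divergence_def e_def Let_def)
  also have "\<dots> = (\<Sum>a\<in>UNIV. \<Sum>i\<in>UNIV. \<Sum>m\<in>UNIV. (e a $ i * e a $ m) * nabla_coord g c m \<alpha> x [i, j])"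
    by (simp add: interior_product_def nabla_def sum_distrib_left mult.assoc)
  also have "\<dots> = (\<Sum>i\<in>UNIV. \<Sum>a\<in>UNIV. \<Sum>m\<in>UNIV. (e a $ i * e a $ m) * nabla_coord g c m \<alpha> x [i, j])"
    by (rule sum.swap)
  also have "\<dots> = (\<Sum>i\<in>UNIV. \<Sum>m\<in>UNIV. \<Sum>a\<in>UNIV. (e a $ i * e a $ m) * nabla_coord g c m \<alpha> x [i, j])"
    by (intro sum.cong refl sum.swap)
  also have "\<dots> = (\<Sum>i\<in>UNIV. nabla_coord g c i \<alpha> x [i, j])"
    by (simp add: sum_distrib_right[symmetric] orth if_distrib[of "\<lambda>t. t * _"] cong: if_cong)
  also have "\<dots> = (\<Sum>i\<in>UNIV. dir_deriv (axis i 1) (component \<alpha> c i j) (coord c x))"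
    by (simp add: nabla_coord_pair christoffel_flat[OF M c, of g, OF flat])
  finally show ?thesis by simp
qed

text \<open>
  Setting two indices of the Killing equation equal and summing gives
  \<open>\<partial>\<^sub>k tr \<alpha> = - 2 \<Sum>\<^sub>i \<partial>\<^sub>i \<alpha>\<^sub>i\<^sub>k\<close>, so a divergence-free Killing tensor has constant trace.  The
  constraints of second order are derivatives of those of first order, which hold on a
  neighbourhood.
\<close>

lemma jet_map_in_jets:
  fixes g :: "('a, 'n::finite) tensor"
  assumes M: "smooth_manifold M A" and g: "riemannian_metric A g" and c: "c \<in> A" "x \<in> cdom c"
    and flat: "\<And>z i j. z \<in> cdom c \<Longrightarrow> g c z [i, j] = (if i = j then 1 else 0)"
    and \<alpha>: "\<alpha> \<in> div_free_killing A g 2"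
  shows "jet_map c x \<alpha> \<in> fibre_constant pair_class \<times> first_jets \<times> second_jets"
proof -
  let ?U = "coord c ` cdom c" and ?D = "\<lambda>k. dir_deriv (axis k 1 :: real^'n)" and ?h = "component \<alpha> c"
  have k: "\<alpha> \<in> killing_2_tensors A g" using div_free_killing_subset[OF g] \<alpha> by blast
  have s: "\<alpha> \<in> sym_tensors A 2" and div: "divergence A g 2 \<alpha> = 0"
    using \<alpha> by (simp_all add: div_free_killing_def)
  have U: "open ?U" by (rule chart_open[OF M c(1)])
  have x: "coord c x \<in> ?U" using c by simp
  note sm = smooth_on_component[OF s c(1)]
  have sw: "?h i j = ?h j i" for i j by (rule component_swap[OF s])
  have cyc: "?D i (?h j k) y + ?D j (?h i k) y + ?D k (?h i j) y = 0" if "y \<in> ?U" for i j k y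
    by (rule flat_killing_equation[OF M c(1) flat k that])
  have tr: "(\<Sum>i\<in>UNIV. ?D k (?h i i) y) = 0" if y: "y \<in> ?U" for k y
  proof -
    have "(\<Sum>i\<in>UNIV. ?D i (?h i k) y) = 0"
      using flat_divergence_equation[OF M g c(1) param_in_cdom[OF M c(1) y] flat div, of k]
      by (simp add: coord_param[OF M c(1) y])
    moreover have "?D k (?h i i) y = - 2 * ?D i (?h i k) y" for i
      using cyc[OF y, of k i i] sw[of k i] by simp
    ultimately show ?thesis
      by (simp add: sum_negf sum_distrib_left[symmetric])
  qed
  have diff1: "?D k (?h i j) differentiable (at (coord c x))" for k i j
    by (rule smooth_on_differentiable[OF smooth_on_dir_deriv[OF sm] x])
  have cyc2: "?D l (?D i (?h j k)) (coord c x) + ?D l (?D j (?h i k)) (coord c x) + ?D l (?D k (?h i j)) (coord c x) = 0"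
    for l i j k
  proof -
    have "?D l (\<lambda>y. ?D i (?h j k) y + ?D j (?h i k) y + ?D k (?h i j) y) (coord c x) = ?D l (\<lambda>_. 0) (coord c x)"
      by (rule dir_deriv_cong[OF U x cyc])
    then show ?thesis
      by (simp add: dir_deriv_add diff1 differentiable_add dir_deriv_const)
  qed
  have tr2: "(\<Sum>i\<in>UNIV. ?D l (?D k (?h i i)) (coord c x)) = 0" for l k
  proof -
    have "?D l (\<lambda>y. \<Sum>i\<in>UNIV. ?D k (?h i i) y) (coord c x) = ?D l (\<lambda>_. 0) (coord c x)"
      by (rule dir_deriv_cong[OF U x tr])
    then show ?thesis
      by (simp add: dir_deriv_sum diff1 dir_deriv_const)
  qed
  have "?D l (?D k (?h i j)) (coord c x) = ?D k (?D l (?h i j)) (coord c x)" for l k i j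
    by (rule second_dir_deriv_commute[OF U sm x])
  then have "snd (snd (jet_map c x \<alpha>)) \<in> second_jets"
    unfolding second_jets_def jet_map_def using cyc2 tr2 sw by simp
  moreover have "fst (snd (jet_map c x \<alpha>)) \<in> first_jets"
    unfolding first_jets_def jet_map_def using cyc[OF x] tr[OF x] sw by simp
  moreover have "fst (jet_map c x \<alpha>) \<in> fibre_constant pair_class"
  proof -
    have "fst (jet_map c x \<alpha>) $ (i, j) = fst (jet_map c x \<alpha>) $ (j, i)" for i j
      unfolding jet_map_def by (simp add: sw[of i j])
    then show ?thesis
      by (auto simp: fibre_constant_def add_eq_conv_ex)
  qed
  ultimately show ?thesis
    by (simp add: mem_Times_iff)
qed

theorem corollary1p2:
  fixes M :: "'a topology" and A :: "('a, 'n::finite) chart set" and f :: "'a \<Rightarrow> real"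
  assumes "smooth_manifold M A" and "compact_space M" and "connected_space M"
    and "morse_function M A f"
    and "\<exists>!x. critical_point M A f x \<and> morse_index A f x = 0"
    and "\<not> (\<exists>x. critical_point M A f x \<and> morse_index A f x = 1)"
  shows "\<forall>g. riemannian_metric A g \<and> adapted_metric M A f g \<longrightarrow>
    (\<exists>B. finite B \<and> div_free_killing A g 2 \<subseteq> tensor.span B) \<and>
    real (tensor.dim (div_free_killing A g 2)) \<le> K0_2 CARD('n)"
proof (intro allI impI, elim conjE)
  fix g assume g: "riemannian_metric A g" and adapted: "adapted_metric M A f g"
  obtain x where "critical_point M A f x" using assms(5) by blast
  then obtain c where c: "c \<in> A" "x \<in> cdom c"
    and flat: "\<And>z i j. z \<in> cdom c \<Longrightarrow> g c z [i, j] = (if i = j then 1 else 0)"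
    using adapted unfolding adapted_metric_def by blast
  let ?S2 = "fibre_constant pair_class :: (real^('n \<times> 'n)) set"
  let ?W = "?S2 \<times> first_jets \<times> second_jets :: ((real^('n \<times> 'n)) \<times> (real^('n \<times> 'n \<times> 'n)) \<times> (real^('n \<times> 'n \<times> 'n \<times> 'n))) set"
  have sym: "\<And>\<alpha>. \<alpha> \<in> killing_2_tensors A g \<Longrightarrow> \<alpha> \<in> sym_tensors A 2"
    by (simp add: killing_2_tensors_def)
  have main: "(\<exists>B. finite B \<and> div_free_killing A g 2 \<subseteq> tensor.span B) \<and> tensor.dim (div_free_killing A g 2) \<le> dim ?W"
  proof (rule dim_le_via_injection[of _ "killing_2_tensors A g" _ "jet_map c x"])
    show "vector_space (scale_tensor :: real \<Rightarrow> ('a, 'n) tensor \<Rightarrow> _)" by (rule tensor.vector_space_axioms)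
    show "tensor.subspace (killing_2_tensors A g)" by (rule killing_2_tensors_subspace[OF assms(1)])
    show "div_free_killing A g 2 \<subseteq> killing_2_tensors A g" by (rule div_free_killing_subset[OF g])
    show "jet_map c x (\<alpha> + \<beta>) = jet_map c x \<alpha> + jet_map c x \<beta>"
      if "\<alpha> \<in> killing_2_tensors A g" "\<beta> \<in> killing_2_tensors A g" for \<alpha> \<beta>
      by (rule jet_map_add[OF assms(1) c sym[OF that(1)] sym[OF that(2)]])
    show "jet_map c x (scale_tensor r \<alpha>) = r *\<^sub>R jet_map c x \<alpha>" if "\<alpha> \<in> killing_2_tensors A g" for r \<alpha>
      by (rule jet_map_scale[OF assms(1) c sym[OF that]])
    show "\<alpha> = 0" if "\<alpha> \<in> killing_2_tensors A g" "jet_map c x \<alpha> = 0" for \<alpha>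
      by (rule jet_map_eq_0[OF assms(1,3) g c that])
    show "jet_map c x ` div_free_killing A g 2 \<subseteq> ?W"
      using jet_map_in_jets[OF assms(1) g c flat] by blast
  qed
  have "dim ?W = ((CARD('n) + 1) choose 2) + dim (first_jets :: (real^('n \<times> 'n \<times> 'n)) set)
      + dim (second_jets :: (real^('n \<times> 'n \<times> 'n \<times> 'n)) set)"
    by (simp add: dim_Times subspace_Times subspace_fibre_constant subspace_first_jets subspace_second_jets
        dim_fibre_constant card_range_pair_class)
  then have "real (dim ?W) \<le> K0_2 CARD('n)"
    using jet_dimension_bound[where 'n='n] by simp
  moreover have "real (tensor.dim (div_free_killing A g 2)) \<le> real (dim ?W)"
    using main by simp
  ultimately have "real (tensor.dim (div_free_killing A g 2)) \<le> K0_2 CARD('n)"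
    by linarith
  with main show "(\<exists>B. finite B \<and> div_free_killing A g 2 \<subseteq> tensor.span B) \<and>
    real (tensor.dim (div_free_killing A g 2)) \<le> K0_2 CARD('n)"
    by blast
qed

end
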